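(* The Poisson structure on the space of chains $(\mathbb A,(B_1,C_1),\dots,(B_j,C_j))\in\mathcal A\times (GL_N(\mathbb C)\times GL_N(\mathbb C))^{j}$ compatible with the multiple product $$(\mathbb A,B_1,C_1)\circ(B_1\mathbb AC_1^{\mathrm T},B_2,C_2)\circ\cdots\circ(B_{j-1}\cdots B_1\mathbb AC_1^{\mathrm T}\cdots C_{j-1}^{\mathrm T},B_j,C_j)=(\mathbb A,B_j\cdots B_1,C_j\cdots C_1)$$ has the following form: $$\{\overset{1}{\mathbb A},\overset{2}{\mathbb A}\}=r_{12}\overset{1}{\mathbb A}\overset{2}{\mathbb A}-\overset{1}{\mathbb A}\overset{2}{\mathbb A}r_{12}+\overset{1}{\mathbb A}r_{12}^{t_1}\overset{2}{\mathbb A}-\overset{2}{\mathbb A}r_{12}^{t_1}\overset{1}{\mathbb A};$$ $$\{\overset{1}{B_1},\overset{2}{\mathbb A}\}=\overset{1}{B_1}Q^{[0]}_{12}\overset{2}{\mathbb A}+\overset{1}{B_1}\overset{2}{\mathbb A}(Q^{[0]}_{12})^{t_2},\qquad \{\overset{1}{C_1},\overset{2}{\mathbb A}\}=\overset{1}{C_1}Q^{[0]}_{12}\overset{2}{\mathbb A}+\overset{1}{C_1}\overset{2}{\mathbb A}(Q^{[0]}_{12})^{t_2};$$ $B_k$ and $C_k$ with $k\ge2$ Poisson commute with $\mathbb A$; for every $k=1,\dots,j$, $$\{\overset{1}{B_k},\overset{2}{B_k}\}=r_{12}\overset{1}{B_k}\overset{2}{B_k}-\overset{1}{B_k}\overset{2}{B_k}r_{12},\quad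 \{\overset{1}{C_k},\overset{2}{C_k}\}=r_{12}\overset{1}{C_k}\overset{2}{C_k}-\overset{1}{C_k}\overset{2}{C_k}r_{12},\quad \{\overset{1}{C_k},\overset{2}{B_k}\}=r_{12}\overset{1}{C_k}\overset{2}{B_k}-\overset{1}{C_k}\overset{2}{B_k}r_{12};$$ and the remaining possibly nonvanishing brackets are, for $k=1,\dots,j-1$, $$\{\overset{1}{B_{k+1}},\overset{2}{B_k}\}=\overset{1}{B_{k+1}}Q^{[k]}_{12}\overset{2}{B_k},\quad \{\overset{1}{C_{k+1}},\overset{2}{B_k}\}=\overset{1}{C_{k+1}}Q^{[k]}_{12}\overset{2}{B_k},$$ $$\{\overset{1}{B_{k+1}},\overset{2}{C_k}\}=\overset{1}{B_{k+1}}Q^{[k]}_{12}\overset{2}{C_k},\quad \{\overset{1}{C_{k+1}},\overset{2}{C_k}\}=\overset{1}{C_{k+1}}Q^{[k]}_{12}\overset{2}{C_k},$$ where each $Q^{[k]}_{12}$, $0\le k\le j-1$, is either (i) $0$, or (ii) $-r_{12}^{t_2}$, or (iii) $r_{12}^{t_1}$ (the choices for different $k$ may be different). That is, these formulas define a Poisson structure which is compatible with the multiple product in the sense given in the context.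
   Context: $\mathcal A=\mathrm{Mat}_N(\mathbb C)$ is the space of (defining matrices of) bilinear forms on $\mathbb C^N$. $E_{i,j}$ are the $N\times N$ matrix units. For an $N\times N$ matrix $X$ write $\overset{1}{X}=X\otimes I$, $\overset{2}{X}=I\otimes X$. For $T\in \mathrm{Mat}_N\otimes\mathrm{Mat}_N$, $T^{t_1}$ and $T^{t_2}$ denote transposition in the first, respectively second, tensor factor. $\{\overset{1}{X},\overset{2}{Y}\}=\sum_{i,j,k,l}\{x_{i,j},y_{k,l}\}E_{i,j}\otimes E_{k,l}$. The classical $r$-matrix is $r_{12}=\sum_i E_{i,i}\otimes E_{i,i}+2\sum_{i>j}E_{i,j}\otimes E_{j,i}$. Given $Q_{12}\in\{0,-r_{12}^{t_2},r_{12}^{t_1}\}$, the triples $(\mathbb A,B,C)\in\mathcal A\times GL_N\times GL_N$ of type $Q$ are the Poisson space with the brackets $$\{\overset{1}{\mathbb A},\overset{2}{\mathbb A}\}=r_{12}\overset{1}{\mathbb A}\overset{2}{\mathbb A}-\overset{1}{\mathbb A}\overset{2}{\mathbb A}r_{12}+\overset{1}{\mathbb A}r_{12}^{t_1}\overset{2}{\mathbb A}-\overset{2}{\mathbb A}r_{12}^{t_1}\overset{1}{\mathbb A},$$ $$\{\overset{1}{B},\overset{2}{\mathbb A}\}=\overset{1}{B}Q_{12}\overset{2}{\mathbb A}+\overset{1}{B}\overset{2}{\mathbb A}Q_{12}^{t_2},\qquad \{\overset{1}{C},\overset{2}{\mathbb A}\}=\overset{1}{C}Q_{12}\overset{2}{\mathbb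 A}+\overset{1}{C}\overset{2}{\mathbb A}Q_{12}^{t_2},$$ $$\{\overset{1}{B},\overset{2}{B}\}=r_{12}\overset{1}{B}\overset{2}{B}-\overset{1}{B}\overset{2}{B}r_{12},\quad \{\overset{1}{C},\overset{2}{C}\}=r_{12}\overset{1}{C}\overset{2}{C}-\overset{1}{C}\overset{2}{C}r_{12},\quad \{\overset{1}{C},\overset{2}{B}\}=r_{12}\overset{1}{C}\overset{2}{B}-\overset{1}{C}\overset{2}{B}r_{12}.$$ Compatibility of a Poisson structure on chains with the multiple product means: the map $(\mathbb A,(B_1,C_1),\dots,(B_j,C_j))\mapsto(\mathbb A,B_j\cdots B_1,C_j\cdots C_1)$ is Poisson to the triples of type $Q^{[0]}$, and for each $k=1,\dots,j$ the map $(\mathbb A,(B_1,C_1),\dots,(B_j,C_j))\mapsto(B_{k-1}\cdots B_1\mathbb AC_1^{\mathrm T}\cdots C_{k-1}^{\mathrm T},B_k,C_k)$ is Poisson to the triples of type $Q^{[k-1]}$. *)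

theory Defs
  imports "HOL-Analysis.Analysis"
begin

text \<open>The index set {1..N} is a finite linearly ordered type (the r-matrix uses the order).
  An element of Mat_N (x) Mat_N is a matrix indexed by pairs: its entry in row (i, k) and
  column (j, l) is the coefficient of E i j (x) E k l, so that the product of the algebra
  Mat_N (x) Mat_N is the matrix product.\<close>

type_synonym 'n cmat = "complex^'n^'n"
type_synonym 'n tensor = "complex^('n \<times> 'n)^('n \<times> 'n)"

definition tensor :: "'n::finite cmat \<Rightarrow> 'n cmat \<Rightarrow> 'n tensor" where
  "tensor X Y = (\<chi> p q. X $ fst p $ fst q * Y $ snd p $ snd q)"

definition E :: "'n::finite \<Rightarrow> 'n \<Rightarrow> 'n cmat" where
  "E i j = (\<chi> a b. if a = i \<and> b = j then 1 else 0)"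

definition leg1 :: "'n::finite cmat \<Rightarrow> 'n tensor" where
  "leg1 X = tensor X (mat 1)"

definition leg2 :: "'n::finite cmat \<Rightarrow> 'n tensor" where
  "leg2 X = tensor (mat 1) X"

definition transp1 :: "'n::finite tensor \<Rightarrow> 'n tensor" where
  "transp1 T = (\<chi> p q. T $ (fst q, snd p) $ (fst p, snd q))"

definition transp2 :: "'n::finite tensor \<Rightarrow> 'n tensor" where
  "transp2 T = (\<chi> p q. T $ (fst p, snd q) $ (fst q, snd p))"

definition rmat :: "'n::{finite,linorder} tensor" where
  "rmat = (\<Sum>i\<in>UNIV. tensor (E i i) (E i i))
        + 2 *\<^sub>R (\<Sum>(i, j)\<in>{(i, j). j < i}. tensor (E i j) (E j i))"

text \<open>Functions on a set X are represented by elements of extensional X.  This is the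
  complex algebra of functions on X generated by (the restrictions of) the functions in G.\<close>

inductive_set generated_algebra :: "'x set \<Rightarrow> ('x \<Rightarrow> complex) set \<Rightarrow> ('x \<Rightarrow> complex) set"
  for X :: "'x set" and G :: "('x \<Rightarrow> complex) set" where
  const: "(\<lambda>x\<in>X. c) \<in> generated_algebra X G"
| gen: "g \<in> G \<Longrightarrow> restrict g X \<in> generated_algebra X G"
| add: "f \<in> generated_algebra X G \<Longrightarrow> g \<in> generated_algebra X G \<Longrightarrow>
    (\<lambda>x\<in>X. f x + g x) \<in> generated_algebra X G"
| mult: "f \<in> generated_algebra X G \<Longrightarrow> g \<in> generated_algebra X G \<Longrightarrow>
    (\<lambda>x\<in>X. f x * g x) \<in> generated_algebra X G"

text \<open>The bracket is an extensional function of its two arguments (undefined unless both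
  are in R), so that it is meaningful to say that it is unique.  Linearity and the Leibniz
  rule in the second argument follow from antisymmetry.\<close>

locale poisson_bracket =
  fixes X :: "'x set"
    and R :: "('x \<Rightarrow> complex) set"
    and br :: "('x \<Rightarrow> complex) \<Rightarrow> ('x \<Rightarrow> complex) \<Rightarrow> 'x \<Rightarrow> complex"
  assumes closed: "br \<in> R \<rightarrow>\<^sub>E R \<rightarrow>\<^sub>E R"
    and linear: "\<And>c f g h. f \<in> R \<Longrightarrow> g \<in> R \<Longrightarrow> h \<in> R \<Longrightarrow>
      br (\<lambda>x\<in>X. c * f x + g x) h = (\<lambda>x\<in>X. c * br f h x + br g h x)"
    and antisymmetric: "\<And>f g. f \<in> R \<Longrightarrow> g \<in> R \<Longrightarrow> br f g = (\<lambda>x\<in>X. - br g f x)"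
    and leibniz: "\<And>f g h. f \<in> R \<Longrightarrow> g \<in> R \<Longrightarrow> h \<in> R \<Longrightarrow>
      br (\<lambda>x\<in>X. f x * g x) h = (\<lambda>x\<in>X. f x * br g h x + br f h x * g x)"
    and jacobi: "\<And>f g h. f \<in> R \<Longrightarrow> g \<in> R \<Longrightarrow> h \<in> R \<Longrightarrow>
      (\<lambda>x\<in>X. br f (br g h) x + br g (br h f) x + br h (br f g) x) = (\<lambda>x\<in>X. 0)"

definition poisson_map ::
  "'x set \<Rightarrow> ('x \<Rightarrow> complex) set \<Rightarrow> (('x \<Rightarrow> complex) \<Rightarrow> ('x \<Rightarrow> complex) \<Rightarrow> 'x \<Rightarrow> complex) \<Rightarrow>
   'y set \<Rightarrow> ('y \<Rightarrow> complex) set \<Rightarrow> (('y \<Rightarrow> complex) \<Rightarrow> ('y \<Rightarrow> complex) \<Rightarrow> 'y \<Rightarrow> complex) \<Rightarrow>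
   ('x \<Rightarrow> 'y) \<Rightarrow> bool" where
  "poisson_map X R br Y S br' \<phi> \<longleftrightarrow>
     \<phi> \<in> X \<rightarrow> Y \<and>
     (\<forall>f\<in>S. compose X f \<phi> \<in> R) \<and>
     (\<forall>f\<in>S. \<forall>g\<in>S. br (compose X f \<phi>) (compose X g \<phi>) = compose X (br' f g) \<phi>)"

text \<open>For matrix-valued functions M and L on X, the tensor with coefficient
  {m_ij, l_kl} at E i j (x) E k l.\<close>

definition mbracket ::
  "'x set \<Rightarrow> (('x \<Rightarrow> complex) \<Rightarrow> ('x \<Rightarrow> complex) \<Rightarrow> 'x \<Rightarrow> complex) \<Rightarrow>
   ('x \<Rightarrow> 'n::finite cmat) \<Rightarrow> ('x \<Rightarrow> 'n cmat) \<Rightarrow> 'x \<Rightarrow> 'n tensor" where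
  "mbracket X br M L x =
     (\<chi> p q. br (\<lambda>y\<in>X. M y $ fst p $ fst q) (\<lambda>y\<in>X. L y $ snd p $ snd q) x)"

definition form_rel where
  "form_rel X br A \<longleftrightarrow> (\<forall>x\<in>X. mbracket X br A A x =
       rmat ** leg1 (A x) ** leg2 (A x) - leg1 (A x) ** leg2 (A x) ** rmat
     + leg1 (A x) ** transp1 rmat ** leg2 (A x) - leg2 (A x) ** transp1 rmat ** leg1 (A x))"

definition action_rel where
  "action_rel X br Q M A \<longleftrightarrow> (\<forall>x\<in>X. mbracket X br M A x =
       leg1 (M x) ** Q ** leg2 (A x) + leg1 (M x) ** leg2 (A x) ** transp2 Q)"

definition group_rel where
  "group_rel X br M L \<longleftrightarrow> (\<forall>x\<in>X. mbracket X br M L x =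
       rmat ** leg1 (M x) ** leg2 (L x) - leg1 (M x) ** leg2 (L x) ** rmat)"

definition link_rel where
  "link_rel X br Q M L \<longleftrightarrow> (\<forall>x\<in>X. mbracket X br M L x = leg1 (M x) ** Q ** leg2 (L x))"

definition commute_rel where
  "commute_rel X br M L \<longleftrightarrow> (\<forall>x\<in>X. mbracket X br M L x = 0)"

text \<open>Mat_N and GL_N are regarded as affine algebraic varieties: the functions on them are
  the regular ones, generated by the matrix entries and, on GL_N, the inverse determinant.\<close>

definition GL :: "'n::finite cmat set" where
  "GL = {M. invertible M}"

definition entries :: "('x \<Rightarrow> 'n::finite cmat) \<Rightarrow> ('x \<Rightarrow> complex) set" where
  "entries M = {(\<lambda>x. M x $ i $ j) | i j. True}"

definition GL_coordinates :: "('x \<Rightarrow> 'n::finite cmat) \<Rightarrow> ('x \<Rightarrow> complex) set" where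
  "GL_coordinates M = insert (\<lambda>x. inverse (det (M x))) (entries M)"

type_synonym 'n triple = "'n cmat \<times> 'n cmat \<times> 'n cmat"

definition trA :: "'n::finite triple \<Rightarrow> 'n cmat" where "trA t = fst t"
definition trB :: "'n::finite triple \<Rightarrow> 'n cmat" where "trB t = fst (snd t)"
definition trC :: "'n::finite triple \<Rightarrow> 'n cmat" where "trC t = snd (snd t)"

definition triples :: "'n::finite triple set" where
  "triples = UNIV \<times> GL \<times> GL"

definition triple_functions :: "('n::finite triple \<Rightarrow> complex) set" where
  "triple_functions =
     generated_algebra triples (entries trA \<union> GL_coordinates trB \<union> GL_coordinates trC)"

definition triple_poisson_structure ::
  "'n::{finite,linorder} tensor \<Rightarrow>
   (('n triple \<Rightarrow> complex) \<Rightarrow> ('n triple \<Rightarrow> complex) \<Rightarrow> 'n triple \<Rightarrow> complex) \<Rightarrow> bool" where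
  "triple_poisson_structure Q br \<longleftrightarrow>
     poisson_bracket triples triple_functions br \<and>
     form_rel triples br trA \<and>
     action_rel triples br Q trB trA \<and>
     action_rel triples br Q trC trA \<and>
     group_rel triples br trB trB \<and>
     group_rel triples br trC trC \<and>
     group_rel triples br trC trB"

text \<open>A chain (A, (B_1, C_1), ..., (B_j, C_j)) is a pair of A and a function on the indices;
  the function is undefined outside {1..j}.\<close>

type_synonym 'n chain = "'n cmat \<times> (nat \<Rightarrow> 'n cmat \<times> 'n cmat)"

definition chA :: "'n::finite chain \<Rightarrow> 'n cmat" where "chA s = fst s"
definition chB :: "nat \<Rightarrow> 'n::finite chain \<Rightarrow> 'n cmat" where "chB k s = fst (snd s k)"
definition chC :: "nat \<Rightarrow> 'n::finite chain \<Rightarrow> 'n cmat" where "chC k s = snd (snd s k)"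

definition chains :: "nat \<Rightarrow> 'n::finite chain set" where
  "chains j = UNIV \<times> ({1..j} \<rightarrow>\<^sub>E GL \<times> GL)"

definition chain_functions :: "nat \<Rightarrow> ('n::finite chain \<Rightarrow> complex) set" where
  "chain_functions j = generated_algebra (chains j)
     (entries chA \<union> (\<Union>k\<in>{1..j}. GL_coordinates (chB k) \<union> GL_coordinates (chC k)))"

definition chain_poisson_structure ::
  "nat \<Rightarrow> (nat \<Rightarrow> 'n::{finite,linorder} tensor) \<Rightarrow>
   (('n chain \<Rightarrow> complex) \<Rightarrow> ('n chain \<Rightarrow> complex) \<Rightarrow> 'n chain \<Rightarrow> complex) \<Rightarrow> bool" where
  "chain_poisson_structure j Q br \<longleftrightarrow>
     poisson_bracket (chains j) (chain_functions j) br \<and>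
     form_rel (chains j) br chA \<and>
     action_rel (chains j) br (Q 0) (chB 1) chA \<and>
     action_rel (chains j) br (Q 0) (chC 1) chA \<and>
     (\<forall>k\<in>{2..j}. commute_rel (chains j) br (chB k) chA \<and> commute_rel (chains j) br (chC k) chA) \<and>
     (\<forall>k\<in>{1..j}. group_rel (chains j) br (chB k) (chB k) \<and>
                  group_rel (chains j) br (chC k) (chC k) \<and>
                  group_rel (chains j) br (chC k) (chB k)) \<and>
     (\<forall>k\<in>{1..<j}. link_rel (chains j) br (Q k) (chB (k + 1)) (chB k) \<and>
                   link_rel (chains j) br (Q k) (chC (k + 1)) (chB k) \<and>
                   link_rel (chains j) br (Q k) (chB (k + 1)) (chC k) \<and>
                   link_rel (chains j) br (Q k) (chC (k + 1)) (chC k)) \<and>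
     (\<forall>k\<in>{1..j}. \<forall>l\<in>{1..j}. l + 2 \<le> k \<longrightarrow>
        commute_rel (chains j) br (chB k) (chB l) \<and>
        commute_rel (chains j) br (chC k) (chB l) \<and>
        commute_rel (chains j) br (chB k) (chC l) \<and>
        commute_rel (chains j) br (chC k) (chC l))"

primrec prodB :: "nat \<Rightarrow> 'n::finite chain \<Rightarrow> 'n cmat" where
  "prodB 0 s = mat 1"
| "prodB (Suc k) s = chB (Suc k) s ** prodB k s"

primrec prodC :: "nat \<Rightarrow> 'n::finite chain \<Rightarrow> 'n cmat" where
  "prodC 0 s = mat 1"
| "prodC (Suc k) s = chC (Suc k) s ** prodC k s"

text \<open>form_after k s is B_k ... B_1 A C_1^T ... C_k^T.\<close>

primrec form_after :: "nat \<Rightarrow> 'n::finite chain \<Rightarrow> 'n cmat" where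
  "form_after 0 s = chA s"
| "form_after (Suc k) s = chB (Suc k) s ** form_after k s ** transpose (chC (Suc k) s)"

definition multiple_product :: "nat \<Rightarrow> 'n::finite chain \<Rightarrow> 'n triple" where
  "multiple_product j s = (chA s, prodB j s, prodC j s)"

definition chain_factor :: "nat \<Rightarrow> 'n::finite chain \<Rightarrow> 'n triple" where
  "chain_factor k s = (form_after (k - 1) s, chB k s, chC k s)"

text \<open>The bracket br' is determined by Q, since a bracket of type Q is prescribed on
  generators of the algebra of functions.\<close>

definition poisson_to_triples ::
  "nat \<Rightarrow> (('n chain \<Rightarrow> complex) \<Rightarrow> ('n chain \<Rightarrow> complex) \<Rightarrow> 'n chain \<Rightarrow> complex) \<Rightarrow>
   'n::{finite,linorder} tensor \<Rightarrow> ('n chain \<Rightarrow> 'n triple) \<Rightarrow> bool" where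
  "poisson_to_triples j br Q \<phi> \<longleftrightarrow>
     (\<exists>br'. triple_poisson_structure Q br' \<and>
       poisson_map (chains j) (chain_functions j) br triples triple_functions br' \<phi>)"

definition compatible ::
  "nat \<Rightarrow> (nat \<Rightarrow> 'n::{finite,linorder} tensor) \<Rightarrow>
   (('n chain \<Rightarrow> complex) \<Rightarrow> ('n chain \<Rightarrow> complex) \<Rightarrow> 'n chain \<Rightarrow> complex) \<Rightarrow> bool" where
  "compatible j Q br \<longleftrightarrow>
     poisson_to_triples j br (Q 0) (multiple_product j) \<and>
     (\<forall>k\<in>{1..j}. poisson_to_triples j br (Q (k - 1)) (chain_factor k))"

end

theory Submission
  imports Defs
begin

text \<open>The r-matrix acts on a pair of indices as a swap, (a, c) going to (c, a), with the coefficient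
  1 + sgn (a - c). If one attaches to every matrix of the chain a slot for its row index and a slot
  for its column index, all prescribed brackets therefore have the same shape: the bracket of two
  matrix entries is the sum over pairs of slots of the terms in which the two indices are swapped,
  with coefficient sgn (a - c) + sgn (s - t) for slots s, t of one totally ordered group, and 0 for
  slots of different groups. The three choices of Q correspond to placing the column slots of one
  pair (B, C) above, below or apart from the row slots of the preceding one. The Jacobi identity on
  entries splits into one Yang-Baxter equation for each triple of slots, which fails only for three
  equal slots; these defects cancel between the rows and the columns of a matrix.

  A bracket with given values on the matrix entries is built from partial derivatives. Derivations at
  a point vanish once they vanish on the entries, which yields uniqueness, the Jacobi identity and
  the criterion for Poisson maps, so that compatibility is a computation with matrices.\<close>

text \<open>The rule restrict_apply would unfold a restricted function to a conditional.\<close>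

declare restrict_apply [simp del] restrict_apply' [simp]

subsection \<open>Algebras of functions and their generators\<close>

text \<open>The generators satisfy relations (a determinant times its inverse is 1), so a bracket
  extended from generators by recursion would raise a question of well-definedness. Partial
  derivatives avoid it: they depend on the function alone, and the regular functions are closed
  under them, so contracting two differentials with an antisymmetric array of regular functions
  gives a biderivation at once.

  The antisymmetric part of r satisfies only the modified Yang-Baxter equation: the cyclic
  expression in the signs of three indices is the constant -1 unless all three are equal. The
  positions of slots in a group obey the same identity, since they too are totally ordered, and they
  enter with the opposite sign. The two constants cancel, while products of an index sign with a
  slot sign cancel on their own. This is why \<open>weight\<close> is a sum of two signs and why a
  group has to be a total order.

  Triples are treated as chains of length one, so that the bracket on the target of each Poisson map
  comes from the same construction as the bracket on chains.\<close>

locale function_algebra =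
  fixes X :: "'x set" and S :: "('x \<Rightarrow> complex) set"
  assumes extensional: "f \<in> S \<Longrightarrow> f \<in> extensional X"
    and const: "(\<lambda>x\<in>X. c) \<in> S"
    and add: "f \<in> S \<Longrightarrow> g \<in> S \<Longrightarrow> (\<lambda>x\<in>X. f x + g x) \<in> S"
    and mult: "f \<in> S \<Longrightarrow> g \<in> S \<Longrightarrow> (\<lambda>x\<in>X. f x * g x) \<in> S"
begin

lemma add': "(\<lambda>x\<in>X. f x) \<in> S \<Longrightarrow> (\<lambda>x\<in>X. g x) \<in> S \<Longrightarrow> (\<lambda>x\<in>X. f x + g x) \<in> S"
  using add[of "\<lambda>x\<in>X. f x" "\<lambda>x\<in>X. g x"] by (simp cong: restrict_cong)

lemma mult': "(\<lambda>x\<in>X. f x) \<in> S \<Longrightarrow> (\<lambda>x\<in>X. g x) \<in> S \<Longrightarrow> (\<lambda>x\<in>X. f x * g x) \<in> S"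
  using mult[of "\<lambda>x\<in>X. f x" "\<lambda>x\<in>X. g x"] by (simp cong: restrict_cong)

lemma restrict_mem: "f \<in> S \<Longrightarrow> (\<lambda>x\<in>X. f x) \<in> S"
  using extensional_restrict[OF extensional] by metis

lemma uminus': "(\<lambda>x\<in>X. f x) \<in> S \<Longrightarrow> (\<lambda>x\<in>X. - f x) \<in> S"
  using mult'[OF const[of "-1"], of f] by simp

lemma sum': "(\<And>a. a \<in> A \<Longrightarrow> (\<lambda>x\<in>X. f a x) \<in> S) \<Longrightarrow> (\<lambda>x\<in>X. \<Sum>a\<in>A. f a x) \<in> S"
  by (induction A rule: infinite_finite_induct) (auto intro: const add')

lemma prod': "(\<And>a. a \<in> A \<Longrightarrow> (\<lambda>x\<in>X. f a x) \<in> S) \<Longrightarrow> (\<lambda>x\<in>X. \<Prod>a\<in>A. f a x) \<in> S"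
  by (induction A rule: infinite_finite_induct) (auto intro: const mult')

lemma det':
  fixes M :: "'x \<Rightarrow> 'n::finite cmat"
  assumes "\<And>i k. (\<lambda>x\<in>X. M x $ i $ k) \<in> S"
  shows "(\<lambda>x\<in>X. det (M x)) \<in> S"
  unfolding det_def by (intro sum' mult' prod' const assms)

end

lemma function_algebra_generated: "function_algebra X (generated_algebra X G)"
proof
  show "f \<in> extensional X" if "f \<in> generated_algebra X G" for f
    using that by induction auto
qed (fact generated_algebra.const generated_algebra.add generated_algebra.mult)+

lemma generated_algebra_minimal:
  assumes "function_algebra X S" "\<And>g. g \<in> G \<Longrightarrow> restrict g X \<in> S" "f \<in> generated_algebra X G"
  shows "f \<in> S"
  using assms(3)
proof induction
  case (const c)
  then show ?case by (rule function_algebra.const[OF assms(1)])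
next
  case (gen g)
  then show ?case by (rule assms(2))
next
  case (add f g)
  then show ?case by (intro function_algebra.add[OF assms(1)])
next
  case (mult f g)
  then show ?case by (intro function_algebra.mult[OF assms(1)])
qed

section \<open>Antisymmetric biderivations, before the Jacobi identity\<close>

locale almost_poisson = function_algebra X R
  for X :: "'x set" and R :: "('x \<Rightarrow> complex) set" +
  fixes br :: "('x \<Rightarrow> complex) \<Rightarrow> ('x \<Rightarrow> complex) \<Rightarrow> 'x \<Rightarrow> complex"
  assumes closed: "br \<in> R \<rightarrow>\<^sub>E R \<rightarrow>\<^sub>E R"
    and linear: "\<And>c f g h. f \<in> R \<Longrightarrow> g \<in> R \<Longrightarrow> h \<in> R \<Longrightarrow>
      br (\<lambda>x\<in>X. c * f x + g x) h = (\<lambda>x\<in>X. c * br f h x + br g h x)"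
    and antisymmetric: "\<And>f g. f \<in> R \<Longrightarrow> g \<in> R \<Longrightarrow> br f g = (\<lambda>x\<in>X. - br g f x)"
    and leibniz: "\<And>f g h. f \<in> R \<Longrightarrow> g \<in> R \<Longrightarrow> h \<in> R \<Longrightarrow>
      br (\<lambda>x\<in>X. f x * g x) h = (\<lambda>x\<in>X. f x * br g h x + br f h x * g x)"
begin

lemma br_mem: "f \<in> R \<Longrightarrow> g \<in> R \<Longrightarrow> br f g \<in> R"
  by (rule PiE_mem[OF PiE_mem[OF closed]])

lemma br_swap: "f \<in> R \<Longrightarrow> g \<in> R \<Longrightarrow> x \<in> X \<Longrightarrow> br f g x = - br g f x"
  using antisymmetric[of f g] by simp

lemma br_add:
  assumes "f \<in> R" "g \<in> R" "h \<in> R" "x \<in> X"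
  shows "br (\<lambda>x\<in>X. f x + g x) h x = br f h x + br g h x"
    and "br h (\<lambda>x\<in>X. f x + g x) x = br h f x + br h g x"
proof -
  show 1: "br (\<lambda>x\<in>X. f x + g x) h x = br f h x + br g h x"
    using linear[of f g h 1] assms by simp
  show "br h (\<lambda>x\<in>X. f x + g x) x = br h f x + br h g x"
    using 1 br_swap[of h "\<lambda>x\<in>X. f x + g x" x] br_swap[of h f x] br_swap[of h g x] assms
      add[of f g] by simp
qed

lemma br_mult:
  assumes "f \<in> R" "g \<in> R" "h \<in> R" "x \<in> X"
  shows "br (\<lambda>x\<in>X. f x * g x) h x = f x * br g h x + br f h x * g x"
    and "br h (\<lambda>x\<in>X. f x * g x) x = f x * br h g x + br h f x * g x"
proof -
  show 1: "br (\<lambda>x\<in>X. f x * g x) h x = f x * br g h x + br f h x * g x"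
    using leibniz[of f g h] assms by simp
  show "br h (\<lambda>x\<in>X. f x * g x) x = f x * br h g x + br h f x * g x"
    using 1 br_swap[of h "\<lambda>x\<in>X. f x * g x" x] br_swap[of h f x] br_swap[of h g x] assms
      mult[of f g] by (simp add: algebra_simps)
qed

text \<open>The Leibniz rule for 1 * 1 = 1 gives b = 2 b, and additivity for 0 + 0 = 0 does the
  same; every constant is c * 1 + 0.\<close>

lemma br_const:
  assumes "h \<in> R" "x \<in> X"
  shows "br (\<lambda>x\<in>X. c) h x = 0" and "br h (\<lambda>x\<in>X. c) x = 0"
proof -
  have "br (\<lambda>x\<in>X. 1) h x = 0"
    using br_mult(1)[OF const[of 1] const[of 1] assms] assms(2) by (simp cong: restrict_cong)
  moreover have "br (\<lambda>x\<in>X. 0) h x = 0"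
    using br_add(1)[OF const[of 0] const[of 0] assms] assms(2) by (simp cong: restrict_cong)
  ultimately show 1: "br (\<lambda>x\<in>X. c) h x = 0"
    using linear[OF const[of 1] const[of 0] assms(1), of c] assms(2) by (simp cong: restrict_cong)
  show "br h (\<lambda>x\<in>X. c) x = 0"
    using 1 br_swap[OF assms(1) const assms(2)] by simp
qed

lemma br_add':
  assumes "(\<lambda>x\<in>X. f x) \<in> R" "(\<lambda>x\<in>X. g x) \<in> R" "h \<in> R" "x \<in> X"
  shows "br (\<lambda>x\<in>X. f x + g x) h x = br (\<lambda>x\<in>X. f x) h x + br (\<lambda>x\<in>X. g x) h x"
    and "br h (\<lambda>x\<in>X. f x + g x) x = br h (\<lambda>x\<in>X. f x) x + br h (\<lambda>x\<in>X. g x) x"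
  using br_add[OF assms] by (simp_all cong: restrict_cong)

lemma br_mult':
  assumes "(\<lambda>x\<in>X. f x) \<in> R" "(\<lambda>x\<in>X. g x) \<in> R" "h \<in> R" "x \<in> X"
  shows "br (\<lambda>x\<in>X. f x * g x) h x = f x * br (\<lambda>x\<in>X. g x) h x + br (\<lambda>x\<in>X. f x) h x * g x"
    and "br h (\<lambda>x\<in>X. f x * g x) x = f x * br h (\<lambda>x\<in>X. g x) x + br h (\<lambda>x\<in>X. f x) x * g x"
  using br_mult[OF assms] assms(4) by (simp_all cong: restrict_cong)

lemma br_sum':
  assumes "\<And>a. a \<in> A \<Longrightarrow> (\<lambda>x\<in>X. f a x) \<in> R" "h \<in> R" "x \<in> X"
  shows "br (\<lambda>x\<in>X. \<Sum>a\<in>A. f a x) h x = (\<Sum>a\<in>A. br (\<lambda>x\<in>X. f a x) h x)"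
    and "br h (\<lambda>x\<in>X. \<Sum>a\<in>A. f a x) x = (\<Sum>a\<in>A. br h (\<lambda>x\<in>X. f a x) x)"
proof -
  show 1: "br (\<lambda>x\<in>X. \<Sum>a\<in>A. f a x) h x = (\<Sum>a\<in>A. br (\<lambda>x\<in>X. f a x) h x)"
    using assms(1)
  proof (induction A rule: infinite_finite_induct)
    case (insert a A)
    then show ?case
      using br_add'(1)[OF _ sum'[of A f] assms(2,3), of "f a"] by simp
  qed (simp_all add: br_const assms)
  have "br h (\<lambda>x\<in>X. \<Sum>a\<in>A. f a x) x = - br (\<lambda>x\<in>X. \<Sum>a\<in>A. f a x) h x"
    by (intro br_swap sum' assms)
  also have "\<dots> = (\<Sum>a\<in>A. br h (\<lambda>x\<in>X. f a x) x)"
    unfolding 1 sum_negf[symmetric] by (intro sum.cong refl sym[OF br_swap] assms)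
  finally show "br h (\<lambda>x\<in>X. \<Sum>a\<in>A. f a x) x = (\<Sum>a\<in>A. br h (\<lambda>x\<in>X. f a x) x)" .
qed

definition jacobiator ::
    "'x \<Rightarrow> ('x \<Rightarrow> complex) \<Rightarrow> ('x \<Rightarrow> complex) \<Rightarrow> ('x \<Rightarrow> complex) \<Rightarrow> complex" where
  "jacobiator x f g h = br f (br g h) x + br g (br h f) x + br h (br f g) x"

lemma jacobiator_rotate: "jacobiator x f g h = jacobiator x g h f"
  by (simp add: jacobiator_def)

end

text \<open>Isolates the Jacobi identity, so that a bracket can be constructed first and tested for
  it afterwards, point by point.\<close>

lemma poisson_bracket_iff:
  assumes "function_algebra X R"
  shows "poisson_bracket X R br \<longleftrightarrow> almost_poisson X R br \<and>
    (\<forall>f\<in>R. \<forall>g\<in>R. \<forall>h\<in>R. \<forall>x\<in>X. br f (br g h) x + br g (br h f) x + br h (br f g) x = 0)"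
    (is "_ \<longleftrightarrow> _ \<and> ?jacobi")
proof -
  have "(\<lambda>x\<in>X. u x) = (\<lambda>x\<in>X. 0) \<longleftrightarrow> (\<forall>x\<in>X. u x = (0::complex))" for u
    by (metis (mono_tags, lifting) restrict_apply' restrict_ext)
  note jac = this[of "\<lambda>x. br f (br g h) x + br g (br h f) x + br h (br f g) x" for f g h]
  have "(\<forall>f g h. f \<in> R \<longrightarrow> g \<in> R \<longrightarrow> h \<in> R \<longrightarrow>
      (\<lambda>x\<in>X. br f (br g h) x + br g (br h f) x + br h (br f g) x) = (\<lambda>x\<in>X. 0)) = ?jacobi"
    unfolding jac by blast
  then show ?thesis
    unfolding poisson_bracket_def almost_poisson_def almost_poisson_axioms_def
    using assms by (simp only:) argo
qed

subsection \<open>Point derivations\<close>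

text \<open>Homogeneity follows from the Leibniz rule with a constant factor.\<close>

definition point_derivation ::
    "'x set \<Rightarrow> ('x \<Rightarrow> complex) set \<Rightarrow> 'x \<Rightarrow> (('x \<Rightarrow> complex) \<Rightarrow> complex) \<Rightarrow> bool" where
  "point_derivation X R x d \<longleftrightarrow> (\<forall>c. d (\<lambda>x\<in>X. c) = 0) \<and>
    (\<forall>f\<in>R. \<forall>g\<in>R. d (\<lambda>x\<in>X. f x + g x) = d f + d g \<and>
      d (\<lambda>x\<in>X. f x * g x) = f x * d g + d f * g x)"

lemma point_derivation_diff:
  "point_derivation X R x d \<Longrightarrow> point_derivation X R x e \<Longrightarrow>
    point_derivation X R x (\<lambda>f. d f - e f)"
  by (auto simp: point_derivation_def algebra_simps)

context almost_poisson
begin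

lemma point_derivation_br:
  "h \<in> R \<Longrightarrow> x \<in> X \<Longrightarrow> point_derivation X R x (\<lambda>f. br f h x)"
  "h \<in> R \<Longrightarrow> x \<in> X \<Longrightarrow> point_derivation X R x (\<lambda>f. br h f x)"
  by (auto simp: point_derivation_def br_add br_mult br_const)

text \<open>A double bracket is a second-order operator in \<open>f\<close>, but in the cyclic sum
  the products of two single brackets occur in pairs of opposite sign, by antisymmetry. Hence the
  Jacobi identity can be tested on coordinates.\<close>

lemma point_derivation_jacobiator:
  assumes "g \<in> R" "h \<in> R" "x \<in> X"
  shows "point_derivation X R x (\<lambda>f. jacobiator x f g h)"
  unfolding point_derivation_def
proof (intro conjI allI ballI)
  note mem = assms br_mem const
  have cong: "br k f' x = br k f'' x"
    if "\<And>y. y \<in> X \<Longrightarrow> f' y = f'' y" "f' \<in> extensional X" "f'' \<in> extensional X" for k f' f''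
    using that by (metis extensionalityI)
  have ext: "br f' f'' \<in> extensional X" if "f' \<in> R" "f'' \<in> R" for f' f''
    using that br_mem extensional by blast
  show "jacobiator x (\<lambda>x\<in>X. c) g h = 0" for c
  proof -
    have "br g (br h (\<lambda>x\<in>X. c)) x = br g (\<lambda>x\<in>X. 0) x" "br h (br (\<lambda>x\<in>X. c) g) x = br h (\<lambda>x\<in>X. 0) x"
      by (intro cong; simp add: br_const ext mem)+
    then show ?thesis
      by (simp add: jacobiator_def br_const mem)
  qed
  fix f f' assume f: "f \<in> R" "f' \<in> R"
  show "jacobiator x (\<lambda>x\<in>X. f x + f' x) g h = jacobiator x f g h + jacobiator x f' g h"
  proof -
    have "br h (\<lambda>x\<in>X. f x + f' x) = (\<lambda>x\<in>X. br h f x + br h f' x)"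
      "br (\<lambda>x\<in>X. f x + f' x) g = (\<lambda>x\<in>X. br f g x + br f' g x)"
      using f by (intro extensionalityI[of _ X]; simp add: br_add ext mem add)+
    then show ?thesis
      using f by (simp add: jacobiator_def br_add mem)
  qed
  show "jacobiator x (\<lambda>x\<in>X. f x * f' x) g h = f x * jacobiator x f' g h + jacobiator x f g h * f' x"
  proof -
    have "br h (\<lambda>x\<in>X. f x * f' x) = (\<lambda>x\<in>X. (\<lambda>x\<in>X. f x * br h f' x) x + (\<lambda>x\<in>X. br h f x * f' x) x)"
      "br (\<lambda>x\<in>X. f x * f' x) g = (\<lambda>x\<in>X. (\<lambda>x\<in>X. f x * br f' g x) x + (\<lambda>x\<in>X. br f g x * f' x) x)"
      using f by (intro extensionalityI[of _ X]; simp add: br_mult ext mem mult)+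
    then have "jacobiator x (\<lambda>x\<in>X. f x * f' x) g h = 
        f x * br f' (br g h) x + br f (br g h) x * f' x
      + (f x * br g (br h f') x + br g f x * br h f' x + (br h f x * br g f' x + br g (br h f) x * f' x))
      + (f x * br h (br f' g) x + br h f x * br f' g x + (br f g x * br h f' x + br h (br f g) x * f' x))"
      using f by (simp add: jacobiator_def br_add br_mult mem mult)
    then show ?thesis
      using f br_swap[of f g x] br_swap[of f' g x] assms
      by (simp add: jacobiator_def algebra_simps)
  qed
qed

end

subsection \<open>Spaces with matrix coordinates\<close>

text \<open>Common frame for triples and chains. Partial derivatives rest on \<open>upd\<close>,
  which moves one matrix and keeps the others fixed.\<close>

locale matrix_coordinates =
  fixes X :: "'x set" and I :: "'i set" and J :: "'i set"
    and M :: "'i \<Rightarrow> 'x \<Rightarrow> 'n::finite cmat" and upd :: "'i \<Rightarrow> 'n cmat \<Rightarrow> 'x \<Rightarrow> 'x"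
  assumes finite_I: "finite I" and J_subset: "J \<subseteq> I"
    and upd_mem: "x \<in> X \<Longrightarrow> i \<in> I \<Longrightarrow> (i \<in> J \<Longrightarrow> invertible Y) \<Longrightarrow> upd i Y x \<in> X"
    and M_upd: "x \<in> X \<Longrightarrow> i \<in> I \<Longrightarrow> k \<in> I \<Longrightarrow> M k (upd i Y x) = (if k = i then Y else M k x)"
    and upd_M: "x \<in> X \<Longrightarrow> i \<in> I \<Longrightarrow> upd i (M i x) x = x"
    and M_invertible: "x \<in> X \<Longrightarrow> i \<in> J \<Longrightarrow> invertible (M i x)"
begin

definition generators :: "('x \<Rightarrow> complex) set" where
  "generators = (\<Union>i\<in>I. entries (M i)) \<union> (\<Union>i\<in>J. {\<lambda>x. inverse (det (M i x))})"

definition R :: "('x \<Rightarrow> complex) set" where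
  "R = generated_algebra X generators"

definition coord :: "'i \<Rightarrow> 'n \<Rightarrow> 'n \<Rightarrow> 'x \<Rightarrow> complex" where
  "coord i a b = (\<lambda>x\<in>X. M i x $ a $ b)"

sublocale function_algebra X R
  unfolding R_def by (rule function_algebra_generated)

lemma coord_mem: "i \<in> I \<Longrightarrow> coord i a b \<in> R"
  unfolding R_def coord_def
  by (rule generated_algebra.gen) (auto simp: generators_def entries_def)

lemma inverse_det_mem: "i \<in> J \<Longrightarrow> (\<lambda>x\<in>X. inverse (det (M i x))) \<in> R"
  unfolding R_def by (rule generated_algebra.gen) (auto simp: generators_def)

lemma det_nonzero: "x \<in> X \<Longrightarrow> i \<in> J \<Longrightarrow> det (M i x) \<noteq> 0"
  using M_invertible invertible_det_nz by blast

lemma R_minimal: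
  assumes "function_algebra X S" "\<And>i a b. i \<in> I \<Longrightarrow> coord i a b \<in> S"
    "\<And>i. i \<in> J \<Longrightarrow> (\<lambda>x\<in>X. det (M i x)) \<in> S \<Longrightarrow> (\<lambda>x\<in>X. inverse (det (M i x))) \<in> S"
  shows "R \<subseteq> S"
proof
  fix f assume f: "f \<in> R"
  have det: "(\<lambda>x\<in>X. det (M i x)) \<in> S" if "i \<in> J" for i
    using that J_subset assms(2) by (intro function_algebra.det'[OF assms(1)]) (auto simp: coord_def)
  show "f \<in> S"
  proof (rule generated_algebra_minimal[OF assms(1) _ f[unfolded R_def]])
    fix g assume "g \<in> generators"
    then consider i a b where "i \<in> I" "g = (\<lambda>x. M i x $ a $ b)"
      | i where "i \<in> J" "g = (\<lambda>x. inverse (det (M i x)))"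
      by (auto simp: generators_def entries_def)
    then show "restrict g X \<in> S"
    proof cases
      case 1
      then show ?thesis using assms(2) by (simp add: coord_def)
    next
      case 2
      then show ?thesis using assms(3) det by simp
    qed
  qed
qed

text \<open>By the Leibniz rule the kernel of \<open>d\<close> in \<open>R\<close> is an algebra.
  For an inverse determinant, apply \<open>d\<close> to the product det * inverse det = 1: since
  \<open>d\<close> kills the determinant, what remains is the nonzero number det(x) times the
  unknown value.\<close>

lemma point_derivation_eq_0:
  assumes d: "point_derivation X R x d" and x: "x \<in> X"
    and coord: "\<And>i a b. i \<in> I \<Longrightarrow> d (coord i a b) = 0" and f: "f \<in> R"
  shows "d f = 0"
proof -
  have "R \<subseteq> {f \<in> R. d f = 0}"
  proof (rule R_minimal)
    show "function_algebra X {f \<in> R. d f = 0}"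
      using d by unfold_locales (auto simp: point_derivation_def extensional const add mult)
    show "coord i a b \<in> {f \<in> R. d f = 0}" if "i \<in> I" for i a b
      using that coord coord_mem by simp
    fix i assume i: "i \<in> J" and "(\<lambda>x\<in>X. det (M i x)) \<in> {f \<in> R. d f = 0}"
    then have det: "(\<lambda>x\<in>X. det (M i x)) \<in> R" "d (\<lambda>x\<in>X. det (M i x)) = 0" by auto
    have "d (\<lambda>x\<in>X. (\<lambda>x\<in>X. det (M i x)) x * (\<lambda>x\<in>X. inverse (det (M i x))) x) = 
       det (M i x) * d (\<lambda>x\<in>X. inverse (det (M i x)))"
      using d det inverse_det_mem[OF i] x unfolding point_derivation_def by simp
    moreover have "(\<lambda>x\<in>X. (\<lambda>x\<in>X. det (M i x)) x * (\<lambda>x\<in>X. inverse (det (M i x))) x) = (\<lambda>x\<in>X. 1)"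
      using det_nonzero[OF _ i] by (intro restrict_ext) simp
    moreover have "d (\<lambda>x\<in>X. 1) = 0"
      using d by (simp add: point_derivation_def)
    ultimately show "(\<lambda>x\<in>X. inverse (det (M i x))) \<in> {f \<in> R. d f = 0}"
      using det_nonzero[OF x i] inverse_det_mem[OF i] by simp
  qed
  with f show ?thesis by auto
qed

lemma point_derivation_eqI:
  assumes "point_derivation X R x d" "point_derivation X R x e" "x \<in> X"
    "\<And>i a b. i \<in> I \<Longrightarrow> d (coord i a b) = e (coord i a b)" "f \<in> R"
  shows "d f = e f"
  using point_derivation_eq_0[OF point_derivation_diff[OF assms(1,2)] assms(3) _ assms(5)] assms(4)
  by simp

text \<open>Agreement passes from coordinates to all functions in one argument at a time.
  Extensionality in both arguments then turns agreement on \<open>R\<close> into equality.\<close>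

lemma almost_poisson_eqI:
  assumes "almost_poisson X R br" "almost_poisson X R br'"
    and coord: "\<And>i k a b c d. i \<in> I \<Longrightarrow> k \<in> I \<Longrightarrow> br (coord i a b) (coord k c d) = br' (coord i a b) (coord k c d)"
  shows "br = br'"
proof -
  interpret A: almost_poisson X R br by fact
  interpret B: almost_poisson X R br' by fact
  have 1: "br f (coord k c d) x = br' f (coord k c d) x" if "f \<in> R" "k \<in> I" "x \<in> X" for f k c d x
    by (rule point_derivation_eqI[OF A.point_derivation_br(1) B.point_derivation_br(1)])
      (use that coord coord_mem in auto)
  have 2: "br f g x = br' f g x" if "f \<in> R" "g \<in> R" "x \<in> X" for f g x
    by (rule point_derivation_eqI[OF A.point_derivation_br(2) B.point_derivation_br(2)])
      (use that 1 coord_mem in auto)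
  have 3: "br f g = br' f g" if "f \<in> R" "g \<in> R" for f g
    using that 2 by (intro extensionalityI[of _ X] extensional A.br_mem B.br_mem) auto
  have 4: "br f = br' f" if "f \<in> R" for f
    using A.closed B.closed that 3
    by (intro extensionalityI[of _ R]) (auto dest: PiE_mem simp: PiE_def)
  show ?thesis
    using A.closed B.closed 4 by (intro extensionalityI[of _ R]) (auto simp: PiE_def)
qed

text \<open>The jacobiator is a derivation in its first argument, and rotation brings each argument
  to that place in turn.\<close>

lemma poisson_bracketI:
  assumes "almost_poisson X R br"
    and coord: "\<And>i k l a b c d e f x. i \<in> I \<Longrightarrow> k \<in> I \<Longrightarrow> l \<in> I \<Longrightarrow> x \<in> X \<Longrightarrow>
      almost_poisson.jacobiator br x (coord i a b) (coord k c d) (coord l e f) = 0"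
  shows "poisson_bracket X R br"
proof -
  interpret almost_poisson X R br by fact
  have "jacobiator x f g h = 0" if fgh: "f \<in> R" "g \<in> R" "h \<in> R" and x: "x \<in> X" for f g h x
  proof -
    have 1: "jacobiator x f (coord k c d) (coord l a b) = 0" if "f \<in> R" "k \<in> I" "l \<in> I" for f k c d l a b
      by (rule point_derivation_eq_0[OF point_derivation_jacobiator])
        (use that coord x coord_mem in auto)
    have 2: "jacobiator x g f (coord k c d) = 0" if "f \<in> R" "g \<in> R" "k \<in> I" for f g k c d
      by (rule point_derivation_eq_0[OF point_derivation_jacobiator])
        (use that 1 x coord_mem jacobiator_rotate in metis)+
    show ?thesis
      by (rule point_derivation_eq_0[OF point_derivation_jacobiator])
        (use fgh 2 x coord_mem jacobiator_rotate in metis)+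
  qed
  then show ?thesis
    using assms(1) function_algebra_axioms by (simp add: poisson_bracket_iff jacobiator_def)
qed

section \<open>Partial derivatives in the matrix entries\<close>

definition shift :: "'i \<Rightarrow> 'n \<Rightarrow> 'n \<Rightarrow> 'x \<Rightarrow> complex \<Rightarrow> 'x" where
  "shift i a b x t = upd i (\<chi> c d. M i x $ c $ d + (if c = a \<and> d = b then t else 0)) x"

definition D :: "'i \<Rightarrow> 'n \<Rightarrow> 'n \<Rightarrow> ('x \<Rightarrow> complex) \<Rightarrow> 'x \<Rightarrow> complex" where
  "D i a b f = (\<lambda>x\<in>X. deriv (\<lambda>t. f (shift i a b x t)) 0)"

lemma shift_0: "x \<in> X \<Longrightarrow> i \<in> I \<Longrightarrow> shift i a b x 0 = x"
  using upd_M by (simp add: shift_def vec_lambda_eta)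

text \<open>Invertibility is an open condition: the determinant of the shifted matrix is continuous
  in \<open>t\<close> and nonzero at 0. Derivatives at 0 thus see only points of \<open>X\<close>,
  although functions in \<open>R\<close> carry no information outside it.\<close>

lemma shift_mem:
  assumes "x \<in> X" "i \<in> I"
  shows "\<forall>\<^sub>F t in nhds 0. shift i a b x t \<in> X"
proof (cases "i \<in> J")
  case True
  define Y where "Y = (\<lambda>t. \<chi> c d. M i x $ c $ d + (if c = a \<and> d = b then t else 0))"
  have "isCont (\<lambda>t. if P then t else 0 :: complex) 0" for P
    by (cases P) auto
  then have "isCont (\<lambda>t. det (Y t)) 0"
    unfolding det_def Y_def by (auto intro!: continuous_intros)
  moreover have "det (Y 0) \<noteq> 0"
    using det_nonzero[OF assms(1) True] by (simp add: Y_def vec_lambda_eta)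
  ultimately have "\<forall>\<^sub>F t in nhds 0. det (Y t) \<noteq> 0"
    by (simp add: continuous_at_imp_continuous_at_within isCont_def tendsto_imp_eventually_ne
        eventually_nhds_conv_at)
  then show ?thesis
    by eventually_elim (use assms upd_mem invertible_det_nz in \<open>auto simp: shift_def Y_def\<close>)
next
  case False
  with assms show ?thesis by (auto simp: shift_def intro!: always_eventually upd_mem)
qed

lemma has_derivative_coord:
  assumes "x \<in> X" "i \<in> I" "k \<in> I"
  shows "((\<lambda>t. coord k c d (shift i a b x t)) has_field_derivative
    (if k = i \<and> c = a \<and> d = b then 1 else 0)) (at 0)"
proof -
  have "((\<lambda>t. M k x $ c $ d + (if k = i \<and> c = a \<and> d = b then t else 0)) has_field_derivative
    (if k = i \<and> c = a \<and> d = b then 1 else 0)) (at 0)"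
    by (auto intro!: derivative_eq_intros)
  moreover have "\<forall>\<^sub>F t in nhds 0. M k x $ c $ d + (if k = i \<and> c = a \<and> d = b then t else 0) =
      coord k c d (shift i a b x t)"
    using shift_mem[OF assms(1,2), of a b]
    by eventually_elim (use assms M_upd in \<open>auto simp: coord_def shift_def\<close>)
  ultimately show ?thesis
    by (subst (asm) DERIV_cong_ev[OF refl _ refl]) auto
qed

text \<open>The functions whose derivative exists and is again regular form an algebra by the sum
  and product rules; an inverse determinant has the derivative of the determinant times the negative
  of its own square. Closure under \<open>D\<close> is what makes the bracket built below take
  values in \<open>R\<close>.\<close>

lemma
  assumes i: "i \<in> I" and f: "f \<in> R"
  shows has_derivative_R:
      "x \<in> X \<Longrightarrow> ((\<lambda>t. f (shift i a b x t)) has_field_derivative D i a b f x) (at 0)"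
    and D_mem: "D i a b f \<in> R"
proof -
  define S where "S = {f \<in> R. \<exists>g\<in>R. \<forall>x\<in>X. ((\<lambda>t. f (shift i a b x t)) has_field_derivative g x) (at 0)}"
  \<comment> \<open>\<open>h\<close> is an unrestricted formula for \<open>f\<close>; the two agree
    along the shift only near 0, where the shift stays in \<open>X\<close>.\<close>
  have S_I: "f \<in> S" if "f \<in> R" "(\<lambda>x\<in>X. g x) \<in> R"
    "\<And>x. x \<in> X \<Longrightarrow> ((\<lambda>t. h x (shift i a b x t)) has_field_derivative g x) (at 0)"
    "\<And>x y. x \<in> X \<Longrightarrow> y \<in> X \<Longrightarrow> f y = h x y" for f g h
    unfolding S_def
  proof (intro CollectI conjI bexI[of _ "\<lambda>x\<in>X. g x"] ballI)
    fix x assume x: "x \<in> X"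
    have "\<forall>\<^sub>F t in nhds 0. f (shift i a b x t) = h x (shift i a b x t)"
      using shift_mem[OF x i, of a b] by eventually_elim (use that(4)[OF x] in auto)
    then show "((\<lambda>t. f (shift i a b x t)) has_field_derivative (\<lambda>x\<in>X. g x) x) (at 0)"
      using that(3)[OF x] x by (subst DERIV_cong_ev[OF refl _ refl]) auto
  qed (use that in auto)
  have "R \<subseteq> S"
  proof (rule R_minimal)
    show "function_algebra X S"
    proof
      show "f \<in> extensional X" if "f \<in> S" for f
        using that extensional by (auto simp: S_def)
      show "(\<lambda>x\<in>X. c) \<in> S" for c
        by (rule S_I[of _ "\<lambda>_. 0" "\<lambda>_ _. c"]) (auto intro: const)
      fix f f' assume "f \<in> S" "f' \<in> S"
      then obtain g g' where g: "f \<in> R" "f' \<in> R" "g \<in> R" "g' \<in> R"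
        "\<And>x. x \<in> X \<Longrightarrow> ((\<lambda>t. f (shift i a b x t)) has_field_derivative g x) (at 0)"
        "\<And>x. x \<in> X \<Longrightarrow> ((\<lambda>t. f' (shift i a b x t)) has_field_derivative g' x) (at 0)"
        unfolding S_def by blast
      show "(\<lambda>x\<in>X. f x + f' x) \<in> S"
        by (rule S_I[of _ "\<lambda>x. g x + g' x" "\<lambda>_ y. f y + f' y"])
          (use g in \<open>auto intro!: add DERIV_add\<close>)
      show "(\<lambda>x\<in>X. f x * f' x) \<in> S"
      proof (rule S_I[of _ "\<lambda>x. g x * f' x + g' x * f x" "\<lambda>_ y. f y * f' y"])
        show "((\<lambda>t. f (shift i a b x t) * f' (shift i a b x t)) has_field_derivative
            g x * f' x + g' x * f x) (at 0)" if "x \<in> X" for x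
          using DERIV_mult'[OF g(5,6), OF that that] shift_0[OF that i] by (simp add: algebra_simps)
      qed (use g in \<open>auto intro!: mult add' mult' intro: restrict_mem\<close>)
    qed
  next
    show "coord k c d \<in> S" if "k \<in> I" for k c d
      by (rule S_I[of _ "\<lambda>x. if k = i \<and> c = a \<and> d = b then 1 else 0" "\<lambda>_. coord k c d"])
        (use that i has_derivative_coord coord_mem const in auto)
  next
    fix k assume k: "k \<in> J" and "(\<lambda>x\<in>X. det (M k x)) \<in> S"
    then obtain g where g: "g \<in> R"
      "\<And>x. x \<in> X \<Longrightarrow> ((\<lambda>t. (\<lambda>x\<in>X. det (M k x)) (shift i a b x t)) has_field_derivative g x) (at 0)"
      unfolding S_def by blast
    show "(\<lambda>x\<in>X. inverse (det (M k x))) \<in> S"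
    proof (rule S_I[of _ "\<lambda>x. - (inverse (det (M k x)) * g x * inverse (det (M k x)))"
          "\<lambda>_ y. inverse ((\<lambda>x\<in>X. det (M k x)) y)"])
      show "((\<lambda>t. inverse ((\<lambda>x\<in>X. det (M k x)) (shift i a b x t))) has_field_derivative
          - (inverse (det (M k x)) * g x * inverse (det (M k x)))) (at 0)" if "x \<in> X" for x
        using DERIV_inverse'[OF g(2)[OF that]] det_nonzero[OF that k] shift_0[OF that i] that by simp
    qed (use g k inverse_det_mem restrict_mem in \<open>auto intro!: uminus' mult'\<close>)
  qed
  with f obtain g where g: "g \<in> R"
    "\<And>x. x \<in> X \<Longrightarrow> ((\<lambda>t. f (shift i a b x t)) has_field_derivative g x) (at 0)"
    unfolding S_def by blast
  have "D i a b f = g"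
    using g(1) extensional by (intro extensionalityI[of _ X]) (auto simp: D_def DERIV_imp_deriv g(2))
  with g show "x \<in> X \<Longrightarrow> ((\<lambda>t. f (shift i a b x t)) has_field_derivative D i a b f x) (at 0)"
    "D i a b f \<in> R"
    by auto
qed

lemma D_coord:
  "x \<in> X \<Longrightarrow> i \<in> I \<Longrightarrow> k \<in> I \<Longrightarrow>
    D i a b (coord k c d) x = (if k = i \<and> c = a \<and> d = b then 1 else 0)"
  using has_derivative_coord by (simp add: D_def DERIV_imp_deriv)

lemma D_cong_ev:
  assumes "x \<in> X" "i \<in> I" "\<And>y. y \<in> X \<Longrightarrow> f y = h y"
    "((\<lambda>t. h (shift i a b x t)) has_field_derivative g) (at 0)"
  shows "D i a b f x = g"
proof -
  have "\<forall>\<^sub>F t in nhds 0. f (shift i a b x t) = h (shift i a b x t)"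
    using shift_mem[OF assms(1,2), of a b] by eventually_elim (use assms(3) in auto)
  then have "((\<lambda>t. f (shift i a b x t)) has_field_derivative g) (at 0)"
    using assms(4) by (subst DERIV_cong_ev[OF refl _ refl]) auto
  then show ?thesis
    using assms(1) by (simp add: D_def DERIV_imp_deriv)
qed

lemma D_linear:
  assumes "x \<in> X" "i \<in> I" "f \<in> R" "g \<in> R"
  shows "D i a b (\<lambda>x\<in>X. c * f x + g x) x = c * D i a b f x + D i a b g x"
  by (rule D_cong_ev[where h = "\<lambda>x. c * f x + g x"])
    (use assms in \<open>auto intro!: derivative_eq_intros has_derivative_R\<close>)

lemma D_mult:
  assumes "x \<in> X" "i \<in> I" "f \<in> R" "g \<in> R"
  shows "D i a b (\<lambda>x\<in>X. f x * g x) x = f x * D i a b g x + D i a b f x * g x"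
proof (rule D_cong_ev[where h = "\<lambda>x. f x * g x"])
  show "((\<lambda>t. f (shift i a b x t) * g (shift i a b x t)) has_field_derivative
      f x * D i a b g x + D i a b f x * g x) (at 0)"
    using DERIV_mult'[OF has_derivative_R has_derivative_R, OF assms(2,3,1) assms(2,4,1), of a b a b]
      shift_0[OF assms(1,2)] by simp
qed (use assms in auto)

text \<open>This is the bivector field with coefficients \<open>W\<close> evaluated on two
  differentials. On coordinates the differentials are Kronecker deltas, which gives back
  \<open>W\<close>. The Jacobi identity depends on \<open>W\<close> and is left to the quadratic
  case.\<close>

theorem almost_poisson_exists:
  fixes W :: "'i \<times> 'n \<times> 'n \<Rightarrow> 'i \<times> 'n \<times> 'n \<Rightarrow> 'x \<Rightarrow> complex"
  assumes W_mem: "\<And>s t. s \<in> I \<times> UNIV \<Longrightarrow> t \<in> I \<times> UNIV \<Longrightarrow> (\<lambda>x\<in>X. W s t x) \<in> R"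
    and W_swap: "\<And>s t x. s \<in> I \<times> UNIV \<Longrightarrow> t \<in> I \<times> UNIV \<Longrightarrow> x \<in> X \<Longrightarrow> W s t x = - W t s x"
  shows "\<exists>br. almost_poisson X R br \<and> (\<forall>i\<in>I. \<forall>k\<in>I. \<forall>a b c d. \<forall>x\<in>X.
    br (coord i a b) (coord k c d) x = W (i, a, b) (k, c, d) x)"
proof -
  define K :: "('i \<times> 'n \<times> 'n) set" where "K = I \<times> UNIV"
  have K: "finite K" by (simp add: K_def finite_I)
  define d where "d = (\<lambda>(i, a, b). D i a b)"
  define br where "br = (\<lambda>f\<in>R. \<lambda>g\<in>R. \<lambda>x\<in>X. \<Sum>s\<in>K. \<Sum>t\<in>K. d s f x * d t g x * W s t x)"
  have d_mem: "f \<in> R \<Longrightarrow> s \<in> K \<Longrightarrow> d s f \<in> R" for f s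
    using D_mem by (auto simp: d_def K_def)
  have br: "br f g = (\<lambda>x\<in>X. \<Sum>s\<in>K. \<Sum>t\<in>K. d s f x * d t g x * W s t x)" if "f \<in> R" "g \<in> R" for f g
    using that by (simp add: br_def)
  have br_mem: "br f g \<in> R" if "f \<in> R" "g \<in> R" for f g
    unfolding br[OF that] by (intro sum' mult' W_mem restrict_mem d_mem that) (auto simp: K_def)
  have almost: "almost_poisson X R br"
  proof
    show "br \<in> R \<rightarrow>\<^sub>E R \<rightarrow>\<^sub>E R"
      unfolding br_def restrict_PiE_iff using br_mem by (simp add: br)
  next
    fix c f g h assume fgh: "f \<in> R" "g \<in> R" "h \<in> R"
    have m: "(\<lambda>x\<in>X. c * f x + g x) \<in> R"
      using fgh by (intro add' mult' const restrict_mem)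
    have "d s (\<lambda>x\<in>X. c * f x + g x) x = c * d s f x + d s g x" if "x \<in> X" "s \<in> K" for x s
      using that fgh by (auto simp: d_def D_linear K_def)
    then show "br (\<lambda>x\<in>X. c * f x + g x) h = (\<lambda>x\<in>X. c * br f h x + br g h x)"
      using fgh m by (intro extensionalityI[of _ X])
        (auto simp: br sum_distrib_left sum.distrib[symmetric] algebra_simps intro!: sum.cong)
  next
    fix f g assume fg: "f \<in> R" "g \<in> R"
    have "(\<Sum>s\<in>K. \<Sum>t\<in>K. d s f x * d t g x * W s t x) = - (\<Sum>s\<in>K. \<Sum>t\<in>K. d s g x * d t f x * W s t x)"
      if x: "x \<in> X" for x
    proof -
      have "d s f x * d t g x * W s t x = - (d t g x * d s f x * W t s x)" if "s \<in> K" "t \<in> K" for s t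
        using W_swap[of s t x] that x by (simp add: K_def)
      then have "(\<Sum>s\<in>K. \<Sum>t\<in>K. d s f x * d t g x * W s t x) =
          (\<Sum>s\<in>K. \<Sum>t\<in>K. - (d t g x * d s f x * W t s x))"
        by (intro sum.cong refl)
      also have "\<dots> = (\<Sum>t\<in>K. \<Sum>s\<in>K. - (d t g x * d s f x * W t s x))"
        by (rule sum.swap)
      finally show ?thesis by (simp add: sum_negf)
    qed
    then show "br f g = (\<lambda>x\<in>X. - br g f x)"
      using fg by (intro extensionalityI[of _ X]) (auto simp: br)
  next
    fix f g h assume fgh: "f \<in> R" "g \<in> R" "h \<in> R"
    have "d s (\<lambda>x\<in>X. f x * g x) x = f x * d s g x + d s f x * g x" if "x \<in> X" "s \<in> K" for x s
      using that fgh by (auto simp: d_def D_mult K_def)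
    then show "br (\<lambda>x\<in>X. f x * g x) h = (\<lambda>x\<in>X. f x * br g h x + br f h x * g x)"
      using fgh mult[of f g] by (intro extensionalityI[of _ X])
        (auto simp: br sum_distrib_left sum_distrib_right sum.distrib[symmetric] algebra_simps intro!: sum.cong)
  qed
  have "br (coord i a b) (coord k a' b') x = W (i, a, b) (k, a', b') x"
    if ik: "i \<in> I" "k \<in> I" "x \<in> X" for i k a b a' b' x
  proof -
    have "d s (coord i a b) x = (if s = (i, a, b) then 1 else 0)" if "s \<in> K" "i \<in> I" for s i a b
      using that ik D_coord by (auto simp: d_def K_def split: if_splits)
    then have "br (coord i a b) (coord k a' b') x =
      (\<Sum>s\<in>K. \<Sum>t\<in>K. if s = (i, a, b) \<and> t = (k, a', b') then W s t x else 0)"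
      using ik by (auto simp: br coord_mem intro!: sum.cong)
    also have "\<dots> = (\<Sum>s\<in>K. if s = (i, a, b) then W s (k, a', b') x else 0)"
      using K ik by (intro sum.cong refl) (auto simp: K_def)
    also have "\<dots> = W (i, a, b) (k, a', b') x"
      using K ik by (simp add: K_def)
    finally show ?thesis .
  qed
  with almost show ?thesis by blast
qed

end

subsection \<open>Quadratic brackets built from ordered slots\<close>

definition osgn :: "'a::linorder \<Rightarrow> 'a \<Rightarrow> complex" where
  "osgn a c = (if a < c then -1 else if a = c then 0 else 1)"

lemma osgn_swap: "osgn a c = - osgn c a"
  by (auto simp: osgn_def)

text \<open>The modified classical Yang-Baxter equation in scalar form: the constant -1 stands where
  the unmodified equation has 0.\<close>

lemma osgn_cyclic: "osgn a b * osgn b c - osgn b c * osgn a c - osgn a c * osgn a b =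
    (if a = b \<and> b = c then 0 else -1)"
  by (auto simp: osgn_def)

type_synonym slot = "nat \<times> nat"

text \<open>In one group, the weight is the coefficient of r for s > t, of - r_21 for s < t, and of the
  antisymmetric part of r for s = t.\<close>

definition weight :: "slot \<Rightarrow> 'n::linorder \<Rightarrow> slot \<Rightarrow> 'n \<Rightarrow> complex" where
  "weight s a t c = (if fst s = fst t then osgn a c + osgn (snd s) (snd t) else 0)"

lemma weight_swap: "weight s a t c = - weight t c s a"
  using osgn_swap[of a c] osgn_swap[of "snd s" "snd t"] by (simp add: weight_def)

text \<open>The coefficients of [r_12, r_13] + [r_12, r_23] + [r_13, r_23] at the two cyclic permutations
  of the indices.\<close>

definition yang_baxter :: "slot \<Rightarrow> 'n::linorder \<Rightarrow> slot \<Rightarrow> 'n \<Rightarrow> slot \<Rightarrow> 'n \<Rightarrow> complex" where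
  "yang_baxter s a t c u e =
     weight s a t c * weight s c u e - weight t c u e * weight s a t e + weight s a u e * weight t c u a"

definition yang_baxter' :: "slot \<Rightarrow> 'n::linorder \<Rightarrow> slot \<Rightarrow> 'n \<Rightarrow> slot \<Rightarrow> 'n \<Rightarrow> complex" where
  "yang_baxter' s a t c u e =
     weight s a t c * weight t a u e - weight t c u e * weight s a u c - weight s a u e * weight s e t c"

text \<open>In one group the products of an index sign with a slot sign cancel. What is left is
  \<open>osgn_cyclic\<close> for the indices minus \<open>osgn_cyclic\<close> for the positions, so
  that the two constants cancel. If the groups are not all equal, each product has a vanishing
  factor.\<close>

lemma yang_baxter_eq:
  "yang_baxter s a t c u e = (if fst s = fst t \<and> fst t = fst u
     then of_bool (a = c \<and> c = e) - of_bool (s = t \<and> t = u) else 0)"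
proof (cases "fst s = fst t \<and> fst t = fst u")
  case True
  have "yang_baxter s a t c u e =
      (osgn a c * osgn c e - osgn c e * osgn a e - osgn a e * osgn a c)
    - (osgn (snd s) (snd t) * osgn (snd t) (snd u) - osgn (snd t) (snd u) * osgn (snd s) (snd u)
       - osgn (snd s) (snd u) * osgn (snd s) (snd t))"
    using True osgn_swap[of c a] by (simp add: yang_baxter_def weight_def algebra_simps)
  with True show ?thesis
    unfolding osgn_cyclic by (auto simp: prod_eq_iff)
qed (auto simp: yang_baxter_def weight_def)

lemma yang_baxter'_eq:
  "yang_baxter' s a t c u e = (if fst s = fst t \<and> fst t = fst u
     then of_bool (s = t \<and> t = u) - of_bool (a = c \<and> c = e) else 0)"
proof (cases "fst s = fst t \<and> fst t = fst u")
  case True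
  have "yang_baxter' s a t c u e =
      - (osgn a c * osgn c e - osgn c e * osgn a e - osgn a e * osgn a c)
    + (osgn (snd s) (snd t) * osgn (snd t) (snd u) - osgn (snd t) (snd u) * osgn (snd s) (snd u)
       - osgn (snd s) (snd u) * osgn (snd s) (snd t))"
    using True osgn_swap[of e c] by (simp add: yang_baxter'_def weight_def algebra_simps)
  with True show ?thesis
    unfolding osgn_cyclic by (auto simp: prod_eq_iff)
qed (auto simp: yang_baxter'_def weight_def)

text \<open>\<open>v p q r\<close> stands for the product of three matrix entries after the indices
  in the slots \<open>s\<close>, \<open>t\<close>, \<open>u\<close> have been replaced by
  \<open>p\<close>, \<open>q\<close>, \<open>r\<close>.\<close>

definition yang_baxter_sum ::
    "slot \<Rightarrow> 'n::linorder \<Rightarrow> slot \<Rightarrow> 'n \<Rightarrow> slot \<Rightarrow> 'n \<Rightarrow> ('n \<Rightarrow> 'n \<Rightarrow> 'n \<Rightarrow> complex) \<Rightarrow> complex" where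
  "yang_baxter_sum s a t c u e v =
     yang_baxter s a t c u e * v e a c + yang_baxter' s a t c u e * v c e a"

text \<open>For three equal indices both values of \<open>v\<close> coincide, so the index defects
  cancel between the two permutations; only the defect at equal slots survives.\<close>

lemma yang_baxter_sum_eq:
  "yang_baxter_sum s a t c u e v = (if s = t \<and> t = u then v c e a - v e a c else 0)"
  by (auto simp: yang_baxter_sum_def yang_baxter_eq yang_baxter'_eq algebra_simps)

text \<open>The terms that pair a row slot with a column slot are those in which a partially
  transposed r acts.\<close>

definition quad :: "('i \<Rightarrow> slot) \<Rightarrow> ('i \<Rightarrow> slot) \<Rightarrow> ('i \<Rightarrow> 'n \<Rightarrow> 'n::linorder \<Rightarrow> complex) \<Rightarrow>
    'i \<Rightarrow> 'n \<Rightarrow> 'n \<Rightarrow> 'i \<Rightarrow> 'n \<Rightarrow> 'n \<Rightarrow> complex" where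
  "quad rs cs m i a b k c d =
     weight (rs i) a (rs k) c * (m i c b * m k a d) + weight (rs i) a (cs k) d * (m i d b * m k c a)
   + weight (cs i) b (rs k) c * (m i a c * m k b d) + weight (cs i) b (cs k) d * (m i a d * m k c b)"

lemma quad_swap: "quad rs cs m i a b k c d = - quad rs cs m k c d i a b"
  using weight_swap[of "rs i" a "rs k" c] weight_swap[of "rs i" a "cs k" d]
    weight_swap[of "cs i" b "rs k" c] weight_swap[of "cs i" b "cs k" d]
  by (simp add: quad_def algebra_simps)

text \<open>The iterated bracket of the entry (a, b) of M i with that of (c, d) of M k and (e, f) of M l.\<close>

definition quad2 :: "('i \<Rightarrow> slot) \<Rightarrow> ('i \<Rightarrow> slot) \<Rightarrow> ('i \<Rightarrow> 'n \<Rightarrow> 'n::linorder \<Rightarrow> complex) \<Rightarrow>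
    'i \<Rightarrow> 'n \<Rightarrow> 'n \<Rightarrow> 'i \<Rightarrow> 'n \<Rightarrow> 'n \<Rightarrow> 'i \<Rightarrow> 'n \<Rightarrow> 'n \<Rightarrow> complex" where
  "quad2 rs cs m i a b k c d l e f = (let q = quad rs cs m i a b in
     weight (rs k) c (rs l) e * (m k e d * q l c f + q k e d * m l c f)
   + weight (rs k) c (cs l) f * (m k f d * q l e c + q k f d * m l e c)
   + weight (cs k) d (rs l) e * (m k c e * q l d f + q k c e * m l d f)
   + weight (cs k) d (cs l) f * (m k c f * q l e d + q k c f * m l e d))"

text \<open>Choosing the row or the column slot of each of the three entries gives eight Yang-Baxter
  sums. The six mixed ones vanish, since a row slot is never a column slot. The pure row and the
  pure column sum can survive only for i = k = l, and then they are opposite.\<close>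

lemma quad2_cyclic:
  fixes rs cs :: "'i \<Rightarrow> slot" and m :: "'i \<Rightarrow> 'n \<Rightarrow> 'n::linorder \<Rightarrow> complex"
  assumes "inj_on rs {i, k, l}" "inj_on cs {i, k, l}"
    "\<And>i' k'. i' \<in> {i, k, l} \<Longrightarrow> k' \<in> {i, k, l} \<Longrightarrow> rs i' \<noteq> cs k'"
  shows "quad2 rs cs m i a b k c d l e f + quad2 rs cs m k c d l e f i a b
    + quad2 rs cs m l e f i a b k c d = 0" (is "?J = 0")
proof -
  \<comment> \<open>Orients every weight in the order \<open>i\<close>, \<open>k\<close>,
    \<open>l\<close>, so that both sides become polynomials in the same weights.\<close>
  note sw = weight_swap[of "rs l" _ "rs i" _] weight_swap[of "rs l" _ "cs i" _]
    weight_swap[of "cs l" _ "rs i" _] weight_swap[of "cs l" _ "cs i" _]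
    weight_swap[of "rs k" _ "rs i" _] weight_swap[of "rs k" _ "cs i" _]
    weight_swap[of "cs k" _ "rs i" _] weight_swap[of "cs k" _ "cs i" _]
    weight_swap[of "rs l" _ "rs k" _] weight_swap[of "rs l" _ "cs k" _]
    weight_swap[of "cs l" _ "rs k" _] weight_swap[of "cs l" _ "cs k" _]
  have "?J = - (yang_baxter_sum (rs i) a (rs k) c (rs l) e (\<lambda>p q r. m i p b * m k q d * m l r f)
    + yang_baxter_sum (rs i) a (rs k) c (cs l) f (\<lambda>p q r. m i p b * m k q d * m l e r)
    + yang_baxter_sum (rs i) a (cs k) d (rs l) e (\<lambda>p q r. m i p b * m k c q * m l r f)
    + yang_baxter_sum (rs i) a (cs k) d (cs l) f (\<lambda>p q r. m i p b * m k c q * m l e r)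
    + yang_baxter_sum (cs i) b (rs k) c (rs l) e (\<lambda>p q r. m i a p * m k q d * m l r f)
    + yang_baxter_sum (cs i) b (rs k) c (cs l) f (\<lambda>p q r. m i a p * m k q d * m l e r)
    + yang_baxter_sum (cs i) b (cs k) d (rs l) e (\<lambda>p q r. m i a p * m k c q * m l r f)
    + yang_baxter_sum (cs i) b (cs k) d (cs l) f (\<lambda>p q r. m i a p * m k c q * m l e r))"
    unfolding quad2_def quad_def Let_def yang_baxter_sum_def yang_baxter_def yang_baxter'_def sw
    by (simp add: algebra_simps)
  also have "\<dots> = 0"
  proof -
    have slots: "rs i = rs k \<longleftrightarrow> i = k" "rs k = rs l \<longleftrightarrow> k = l" "cs i = cs k \<longleftrightarrow> i = k" "cs k = cs l \<longleftrightarrow> k = l"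
      using assms(1,2) by (auto simp: inj_on_eq_iff)
    have mixed: "rs i \<noteq> cs k" "cs i \<noteq> rs k" "rs k \<noteq> cs l" "cs k \<noteq> rs l"
      using assms(3)[of i k] assms(3)[of k i] assms(3)[of k l] assms(3)[of l k] by auto
    show ?thesis
      unfolding yang_baxter_sum_eq slots by (simp add: mixed)
  qed
  finally show ?thesis .
qed


section \<open>The Poisson bracket attached to an assignment of slots\<close>

locale slotted_coordinates = matrix_coordinates X I J M upd
  for X :: "'x set" and I :: "'i set" and J
    and M :: "'i \<Rightarrow> 'x \<Rightarrow> 'n::{finite,linorder} cmat" and upd +
  fixes rs cs :: "'i \<Rightarrow> slot"
  assumes inj_rs: "inj_on rs I" and inj_cs: "inj_on cs I"
    and rs_neq_cs: "i \<in> I \<Longrightarrow> k \<in> I \<Longrightarrow> rs i \<noteq> cs k"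
begin

definition quad_bracket :: "(('x \<Rightarrow> complex) \<Rightarrow> ('x \<Rightarrow> complex) \<Rightarrow> 'x \<Rightarrow> complex) \<Rightarrow> bool" where
  "quad_bracket br \<longleftrightarrow> (\<forall>i\<in>I. \<forall>k\<in>I. \<forall>a b c d. \<forall>x\<in>X.
     br (coord i a b) (coord k c d) x = quad rs cs (\<lambda>i a b. M i x $ a $ b) i a b k c d)"

lemma quad_mem:
  assumes "i \<in> I" "k \<in> I"
  shows "(\<lambda>x\<in>X. quad rs cs (\<lambda>i a b. M i x $ a $ b) i a b k c d) \<in> R"
proof -
  have "(\<lambda>x\<in>X. M i x $ a $ b) \<in> R" if "i \<in> I" for i a b
    using coord_mem[OF that] by (simp add: coord_def)
  with assms show ?thesis
    unfolding quad_def by (intro add' mult' const)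
qed

lemma jacobiator_coord:
  assumes "almost_poisson X R br" "quad_bracket br" and ikl: "i \<in> I" "k \<in> I" "l \<in> I" and x: "x \<in> X"
  shows "almost_poisson.jacobiator br x (coord i a b) (coord k c d) (coord l e f) = 0"
proof -
  interpret almost_poisson X R br by fact
  let ?m = "\<lambda>x i a b. M i x $ a $ b"
  have br: "br (coord i a b) (coord k c d) x = quad rs cs (?m x) i a b k c d"
    if "i \<in> I" "k \<in> I" "x \<in> X" for i k a b c d x
    using that assms(2) by (simp add: quad_bracket_def)
  have br2: "br (coord i a b) (br (coord k c d) (coord l e f)) x = quad2 rs cs (?m x) i a b k c d l e f"
    if ikl: "i \<in> I" "k \<in> I" "l \<in> I" for i a b k c d l e f
  proof -
    have mem: "(\<lambda>x\<in>X. M i x $ a $ b) \<in> R" if "i \<in> I" for i a b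
      using coord_mem[OF that] by (simp add: coord_def)
    have br': "br (coord i a b) (\<lambda>x\<in>X. M k x $ c $ d) x = quad rs cs (?m x) i a b k c d"
      if "i \<in> I" "k \<in> I" for i k a b c d
      using br[OF that x] by (simp add: coord_def)
    \<comment> \<open>An equality of functions is required here, since the outer bracket acts on the
      function and not on its value at \<open>x\<close>.\<close>
    have kl: "br (coord k c d) (coord l e f) = (\<lambda>x\<in>X. quad rs cs (?m x) k c d l e f)"
      using ikl by (intro extensionalityI[of _ X]) (auto simp: br extensional br_mem coord_mem)
    show ?thesis
      unfolding kl quad_def[of rs cs "?m _" k]
      using ikl by (simp add: br_add' br_mult' add' mult' const mem coord_mem x br_const br' quad2_def Let_def)
  qed
  show ?thesis
    unfolding jacobiator_def using ikl
    by (simp only: br2, intro quad2_cyclic inj_on_subset[OF inj_rs] inj_on_subset[OF inj_cs])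
      (auto simp: rs_neq_cs)
qed

theorem poisson_quad_exists: "\<exists>br. poisson_bracket X R br \<and> quad_bracket br"
proof -
  define W where "W = (\<lambda>(i, a, b) (k, c, d) x. quad rs cs (\<lambda>i a b. M i x $ a $ b) i a b k c d)"
  have "\<exists>br. almost_poisson X R br \<and> (\<forall>i\<in>I. \<forall>k\<in>I. \<forall>a b c d. \<forall>x\<in>X.
    br (coord i a b) (coord k c d) x = W (i, a, b) (k, c, d) x)"
  proof (rule almost_poisson_exists)
    show "(\<lambda>x\<in>X. W s t x) \<in> R" if "s \<in> I \<times> UNIV" "t \<in> I \<times> UNIV" for s t
      using that quad_mem by (auto simp: W_def)
    show "W s t x = - W t s x" for s t x
      unfolding W_def case_prod_beta by (rule quad_swap)
  qed
  then obtain br where br: "almost_poisson X R br" "quad_bracket br"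
    by (auto simp: W_def quad_bracket_def)
  then have "poisson_bracket X R br"
    using jacobiator_coord by (intro poisson_bracketI) auto
  with br show ?thesis by blast
qed

lemma quad_bracket_unique:
  assumes "almost_poisson X R br" "quad_bracket br" "almost_poisson X R br'" "quad_bracket br'"
  shows "br = br'"
proof (rule almost_poisson_eqI[OF assms(1,3)])
  interpret A: almost_poisson X R br by fact
  interpret B: almost_poisson X R br' by fact
  show "br (coord i a b) (coord k c d) = br' (coord i a b) (coord k c d)" if "i \<in> I" "k \<in> I" for i k a b c d
    using assms(2,4) that
    by (intro extensionalityI[of _ X] extensional A.br_mem B.br_mem coord_mem) (auto simp: quad_bracket_def)
qed

end

subsection \<open>Tensor calculus\<close>

lemma sum_UNIV_pair: "(\<Sum>r\<in>UNIV. f r) = (\<Sum>u\<in>UNIV. \<Sum>v\<in>UNIV. f (u, v))"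
  for f :: "'a::finite \<times> 'b::finite \<Rightarrow> 'c::comm_monoid_add"
  by (simp add: sum.cartesian_product)

lemma sum_delta_conj:
  fixes f :: "'a::finite \<Rightarrow> complex"
  shows "(\<Sum>u\<in>UNIV. if u = c \<and> P then f u else 0) = (if P then f c else 0)"
    and "(\<Sum>u\<in>UNIV. if P \<and> u = c then f u else 0) = (if P then f c else 0)"
    and "(\<Sum>u\<in>UNIV. if c = u \<and> P then f u else 0) = (if P then f c else 0)"
    and "(\<Sum>u\<in>UNIV. if P \<and> c = u then f u else 0) = (if P then f c else 0)"
  by (cases P; simp)+

lemma if_times: "(if P then a else 0) * b = (if P then a * b else (0::complex))"
  "b * (if P then a else 0) = (if P then b * a else (0::complex))"
  by auto

lemma leg1_nth: "leg1 X $ p $ q = (if snd p = snd q then X $ fst p $ fst q else 0)"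
  by (simp add: leg1_def tensor_def mat_def)

lemma leg2_nth: "leg2 X $ p $ q = (if fst p = fst q then X $ snd p $ snd q else 0)"
  by (simp add: leg2_def tensor_def mat_def)

lemma leg_times_nth:
  "(leg1 X ** T) $ p $ q = (\<Sum>u\<in>UNIV. X $ fst p $ u * T $ (u, snd p) $ q)"
  "(T ** leg1 X) $ p $ q = (\<Sum>u\<in>UNIV. T $ p $ (u, snd q) * X $ u $ fst q)"
  "(leg2 X ** T) $ p $ q = (\<Sum>u\<in>UNIV. X $ snd p $ u * T $ (fst p, u) $ q)"
  "(T ** leg2 X) $ p $ q = (\<Sum>u\<in>UNIV. T $ p $ (fst q, u) * X $ u $ snd q)"
  by (simp_all add: matrix_matrix_mult_def sum_UNIV_pair leg1_nth leg2_nth if_times sum.swap[of _ UNIV UNIV])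

lemma rmat_nth:
  "rmat $ p $ q = (if snd q = fst p \<and> fst q = snd p then 1 + osgn (fst p) (snd p) else 0)"
proof -
  have "tensor (E i i) (E i i) $ p $ q =
      (if i = fst p \<and> fst q = fst p \<and> snd p = fst p \<and> snd q = fst p then 1 else 0)" for i
    by (auto simp: tensor_def E_def)
  then have 1: "(\<Sum>i\<in>UNIV. tensor (E i i) (E i i)) $ p $ q =
      (if fst q = fst p \<and> snd p = fst p \<and> snd q = fst p then 1 else 0)"
    by (simp only: sum_component sum_delta_conj)
  have "(\<Sum>(i, j)\<in>{(i, j). j < i}. tensor (E i j) (E j i)) $ p $ q =
      (\<Sum>r\<in>{(i, j). j < i}. if r = p \<and> snd q = fst p \<and> fst q = snd p then 1 else 0)"
    unfolding sum_component by (intro sum.cong) (auto simp: tensor_def E_def prod_eq_iff)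
  also have "\<dots> = (\<Sum>r\<in>UNIV. if r = p \<and> snd p < fst p \<and> snd q = fst p \<and> fst q = snd p then 1 else 0)"
    by (rule sum.mono_neutral_cong_left) auto
  finally have 2: "(\<Sum>(i, j)\<in>{(i, j). j < i}. tensor (E i j) (E j i)) $ p $ q =
      (if snd p < fst p \<and> snd q = fst p \<and> fst q = snd p then 1 else 0)"
    by (simp only: sum_delta_conj)
  consider "fst p < snd p" | "snd p = fst p" | "snd p < fst p" by fastforce
  then show ?thesis
    unfolding rmat_def vector_add_component vector_scaleR_component 1 2
    by cases (auto simp: osgn_def scaleR_2)
qed

lemma transp1_rmat_nth:
  "transp1 rmat $ p $ q = (if snd p = fst p \<and> snd q = fst q then 1 + osgn (fst q) (fst p) else 0)"
  by (cases p; cases q; auto simp: transp1_def rmat_nth)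

lemma transp2_rmat_nth:
  "transp2 rmat $ p $ q = (if snd p = fst p \<and> snd q = fst q then 1 + osgn (fst p) (fst q) else 0)"
  by (cases p; cases q; auto simp: transp2_def rmat_nth)

lemma transp2_transp1_rmat_nth:
  "transp2 (transp1 rmat) $ p $ q = (if snd p = fst q \<and> fst p = snd q then 1 + osgn (fst q) (snd q) else 0)"
  by (auto simp: transp2_def transp1_def rmat_nth)

lemma transp2_transp2 [simp]: "transp2 (transp2 T) = T"
  by (simp add: transp2_def vec_eq_iff)

lemma leg1_leg2_nth: "(leg1 X ** leg2 Y) $ p $ q = X $ fst p $ fst q * Y $ snd p $ snd q"
  by (simp add: leg_times_nth leg1_nth if_times sum_delta_conj)

lemma rmat_leg_nth:
  "(rmat ** leg1 X ** leg2 Y) $ p $ q =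
    (1 + osgn (fst p) (snd p)) * (X $ snd p $ fst q * Y $ fst p $ snd q)"
  "(leg1 X ** leg2 Y ** rmat) $ p $ q =
    (1 + osgn (snd q) (fst q)) * (X $ fst p $ snd q * Y $ snd p $ fst q)"
  "(leg1 X ** leg2 Y ** transp2 (transp1 rmat)) $ p $ q =
    (1 + osgn (fst q) (snd q)) * (X $ fst p $ snd q * Y $ snd p $ fst q)"
proof -
  have "rmat $ p $ r = (if r = (snd p, fst p) then 1 + osgn (fst p) (snd p) else 0)" for r
    by (auto simp: rmat_nth prod_eq_iff)
  then show "(rmat ** leg1 X ** leg2 Y) $ p $ q =
      (1 + osgn (fst p) (snd p)) * (X $ snd p $ fst q * Y $ fst p $ snd q)"
    by (simp add: matrix_mul_assoc[symmetric])
      (simp add: matrix_matrix_mult_def[of rmat] leg1_leg2_nth if_times)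
next
  have "rmat $ r $ q = (if r = (snd q, fst q) then 1 + osgn (snd q) (fst q) else 0)" for r
    by (auto simp: rmat_nth prod_eq_iff)
  then show "(leg1 X ** leg2 Y ** rmat) $ p $ q =
      (1 + osgn (snd q) (fst q)) * (X $ fst p $ snd q * Y $ snd p $ fst q)"
    by (simp add: matrix_matrix_mult_def[of _ rmat] leg1_leg2_nth if_times)
next
  have "transp2 (transp1 rmat) $ r $ q = (if r = (snd q, fst q) then 1 + osgn (fst q) (snd q) else 0)" for r
    by (auto simp: transp2_transp1_rmat_nth prod_eq_iff)
  then show "(leg1 X ** leg2 Y ** transp2 (transp1 rmat)) $ p $ q =
      (1 + osgn (fst q) (snd q)) * (X $ fst p $ snd q * Y $ snd p $ fst q)"
    by (simp add: matrix_matrix_mult_def[of _ "transp2 (transp1 rmat)"] leg1_leg2_nth if_times)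
qed

lemma transp_rmat_leg_nth:
  "(leg1 X ** transp1 rmat ** leg2 Y) $ p $ q =
    (1 + osgn (fst q) (snd p)) * (X $ fst p $ snd p * Y $ fst q $ snd q)"
  "(leg2 Y ** transp1 rmat ** leg1 X) $ p $ q =
    (1 + osgn (snd q) (fst p)) * (X $ snd q $ fst q * Y $ snd p $ fst p)"
  "(leg1 X ** transp2 rmat ** leg2 Y) $ p $ q =
    (1 + osgn (snd p) (fst q)) * (X $ fst p $ snd p * Y $ fst q $ snd q)"
  by (simp_all add: matrix_mul_assoc[symmetric])
    (simp_all add: leg_times_nth transp1_rmat_nth transp2_rmat_nth if_times sum_delta_conj)

section \<open>The prescribed brackets in terms of slots\<close>

lemmas relation_nth = rmat_leg_nth transp_rmat_leg_nth

text \<open>\<open>quad\<close> in tensor notation: \<open>p\<close> carries the two row indices and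
  \<open>q\<close> the two column indices.\<close>

definition quad_tensor :: "slot \<Rightarrow> slot \<Rightarrow> slot \<Rightarrow> slot \<Rightarrow> 'n::{finite,linorder} cmat \<Rightarrow> 'n cmat \<Rightarrow> 'n tensor" where
  "quad_tensor s s' t t' X Y = (\<chi> p q.
     weight s (fst p) t (snd p) * (X $ snd p $ fst q * Y $ fst p $ snd q)
   + weight s (fst p) t' (snd q) * (X $ snd q $ fst q * Y $ snd p $ fst p)
   + weight s' (fst q) t (snd p) * (X $ fst p $ snd p * Y $ fst q $ snd q)
   + weight s' (fst q) t' (snd q) * (X $ fst p $ snd q * Y $ snd p $ fst q))"

text \<open>Both legs carry the same matrix, so the row-row and the column-column term contain the
  same product of entries and the constant parts of the two r cancel; this matches the slot sign 0
  at equal slots. The term with + r^{t_1} requires the column slot to lie above the row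
  slot.\<close>

lemma form_tensor:
  fixes X :: "'n::{finite,linorder} cmat"
  assumes "fst s = fst s'" "snd s < snd s'"
  shows "rmat ** leg1 X ** leg2 X - leg1 X ** leg2 X ** rmat
     + leg1 X ** transp1 rmat ** leg2 X - leg2 X ** transp1 rmat ** leg1 X = quad_tensor s s' s s' X X"
  using assms
  by (auto simp add: vec_eq_iff quad_tensor_def relation_nth weight_def osgn_def algebra_simps)

lemma group_tensor_same:
  assumes "fst s \<noteq> fst s'"
  shows "rmat ** leg1 X ** leg2 X - leg1 X ** leg2 X ** rmat = quad_tensor s s' s s' X X"
  using assms
  by (auto simp add: vec_eq_iff quad_tensor_def relation_nth weight_def osgn_def algebra_simps)

text \<open>The factor r on the left has sign + and puts the row slot of \<open>X\<close> above that
  of \<open>Y\<close>; the factor r on the right has sign - and reverses the order for the column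
  slots.\<close>

lemma group_tensor:
  assumes "fst s = fst t" "snd t < snd s" "fst s' = fst t'" "snd s' < snd t'" "fst s \<noteq> fst s'"
  shows "rmat ** leg1 X ** leg2 Y - leg1 X ** leg2 Y ** rmat = quad_tensor s s' t t' X Y"
  using assms
  by (auto simp add: vec_eq_iff quad_tensor_def relation_nth weight_def osgn_def algebra_simps)

definition linked :: "'n::{finite,linorder} tensor \<Rightarrow> slot \<Rightarrow> slot set \<Rightarrow> bool" where
  "linked Q s T \<longleftrightarrow> (Q = 0 \<and> (\<forall>t\<in>T. fst s \<noteq> fst t)) \<or>
     (Q = transp1 rmat \<and> (\<forall>t\<in>T. fst s = fst t \<and> snd t < snd s)) \<or>
     (Q = - transp2 rmat \<and> (\<forall>t\<in>T. fst s = fst t \<and> snd s < snd t))"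

lemma linked_cases:
  assumes "linked Q s T"
  obtains "Q = 0" "\<forall>t\<in>T. fst s \<noteq> fst t"
    | "Q = transp1 rmat" "\<forall>t\<in>T. fst s = fst t \<and> snd t < snd s"
    | "Q = - transp2 rmat" "\<forall>t\<in>T. fst s = fst t \<and> snd s < snd t"
  using assms unfolding linked_def by blast

lemma matrix_times_uminus: "(- X) ** Y = - (X ** Y)" "X ** (- Y) = - (X ** Y)"
  for X :: "complex^'n::finite^'m::finite" and Y :: "complex^'k::finite^'n"
  by (simp_all add: matrix_matrix_mult_def vec_eq_iff sum_negf)

lemma transp_uminus: "transp1 (- T) = - transp1 T" "transp2 (- T) = - transp2 T"
  by (simp_all add: transp1_def transp2_def vec_eq_iff)

lemma transp_0: "transp1 0 = 0" "transp2 0 = 0"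
  by (simp_all add: transp1_def transp2_def vec_eq_iff)

lemma matrix_times_0: "0 ** X = 0" "X ** 0 = 0" for X :: "complex^'n::finite^'m::finite"
  by (simp_all add: matrix_matrix_mult_def vec_eq_iff)

text \<open>The term with Q lets the column slot of \<open>X\<close> meet the row slot of
  \<open>Y\<close>, the term with the transposed Q its column slot; hence \<open>s'\<close> is
  linked to both.\<close>

lemma action_tensor:
  assumes "linked Q s' {t, t'}" "fst s \<noteq> fst t" "fst s \<noteq> fst t'"
  shows "leg1 X ** Q ** leg2 Y + leg1 X ** leg2 Y ** transp2 Q = quad_tensor s s' t t' X Y"
  using assms(1)
proof (cases rule: linked_cases)
  case 1
  show ?thesis
    unfolding 1(1) using assms(2-) 1(2)
    by (simp add: matrix_times_0 transp_0 vec_eq_iff quad_tensor_def weight_def)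
next
  case 2
  show ?thesis
    unfolding 2(1) using assms(2-) 2(2)
    by (auto simp: vec_eq_iff quad_tensor_def relation_nth weight_def osgn_def algebra_simps)
next
  case 3
  show ?thesis
    unfolding 3(1) using assms(2-) 3(2)
    by (auto simp: vec_eq_iff quad_tensor_def relation_nth weight_def osgn_def algebra_simps
        matrix_times_uminus transp_uminus)
qed

text \<open>Here the column slot of \<open>Y\<close> lies in another group than \<open>s'\<close>,
  so that no term with the transposed Q appears.\<close>

lemma link_tensor:
  assumes "linked Q s' {t}" "fst s \<noteq> fst t" "fst s \<noteq> fst t'" "fst s' \<noteq> fst t'"
  shows "leg1 X ** Q ** leg2 Y = quad_tensor s s' t t' X Y"
  using assms(1)
proof (cases rule: linked_cases)
  case 1
  show ?thesis
    unfolding 1(1) using assms(2-) 1(2)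
    by (simp add: matrix_times_0 transp_0 vec_eq_iff quad_tensor_def weight_def)
next
  case 2
  show ?thesis
    unfolding 2(1) using assms(2-) 2(2)
    by (auto simp: vec_eq_iff quad_tensor_def relation_nth weight_def osgn_def algebra_simps)
next
  case 3
  show ?thesis
    unfolding 3(1) using assms(2-) 3(2)
    by (auto simp: vec_eq_iff quad_tensor_def relation_nth weight_def osgn_def algebra_simps
        matrix_times_uminus transp_uminus)
qed

lemma commute_tensor:
  assumes "fst s \<noteq> fst t" "fst s \<noteq> fst t'" "fst s' \<noteq> fst t" "fst s' \<noteq> fst t'"
  shows "0 = quad_tensor s s' t t' X Y"
  using assms by (simp add: vec_eq_iff quad_tensor_def weight_def)

subsection \<open>Brackets of matrix-valued functions\<close>

text \<open>Exchange of the tensor factors, which by antisymmetry relates the brackets of two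
  matrices in the two orders.\<close>

definition flip :: "'n::finite tensor \<Rightarrow> 'n tensor" where
  "flip T = (\<chi> p q. T $ prod.swap p $ prod.swap q)"

context almost_poisson
begin

definition regular :: "('x \<Rightarrow> 'n::finite cmat) \<Rightarrow> bool" where
  "regular M \<longleftrightarrow> (\<forall>a b. (\<lambda>x\<in>X. M x $ a $ b) \<in> R)"

lemma regularD: "regular M \<Longrightarrow> (\<lambda>x\<in>X. M x $ a $ b) \<in> R"
  by (simp add: regular_def)

lemma regular_mult: "regular M \<Longrightarrow> regular L \<Longrightarrow> regular (\<lambda>x. M x ** L x)"
  by (simp add: regular_def matrix_matrix_mult_def) (intro allI sum' mult'; blast)

lemma regular_transpose: "regular M \<Longrightarrow> regular (\<lambda>x. transpose (M x))"
  by (simp add: regular_def transpose_def)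

lemma regular_const: "regular (\<lambda>x. C)"
  by (simp add: regular_def const)

lemma mbracket_flip:
  assumes "regular M" "regular L" "x \<in> X"
  shows "mbracket X br M L x = - flip (mbracket X br L M x)"
  using br_swap[OF regularD[OF assms(1)] regularD[OF assms(2)] assms(3)]
  by (simp add: mbracket_def flip_def vec_eq_iff)

lemma mbracket_const2: "regular M \<Longrightarrow> x \<in> X \<Longrightarrow> mbracket X br M (\<lambda>x. C) x = 0"
  by (simp add: mbracket_def vec_eq_iff br_const regularD)

text \<open>The entrywise Leibniz rule: the undifferentiated factor acts on its own leg, from the
  side on which it stands.\<close>

lemma mbracket_mult:
  assumes "regular M" "regular M'" "regular L" "x \<in> X"
  shows "mbracket X br (\<lambda>x. M x ** M' x) L x =
      leg1 (M x) ** mbracket X br M' L x + mbracket X br M L x ** leg1 (M' x)"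
    and "mbracket X br L (\<lambda>x. M x ** M' x) x =
      leg2 (M x) ** mbracket X br L M' x + mbracket X br L M x ** leg2 (M' x)"
proof -
  note simps = mbracket_def leg_times_nth matrix_matrix_mult_def[of "M _"] sum.distrib[symmetric]
    br_sum' br_mult' mult' regularD assms
  show "mbracket X br (\<lambda>x. M x ** M' x) L x =
      leg1 (M x) ** mbracket X br M' L x + mbracket X br M L x ** leg1 (M' x)"
    by (simp add: vec_eq_iff simps)
  show "mbracket X br L (\<lambda>x. M x ** M' x) x =
      leg2 (M x) ** mbracket X br L M' x + mbracket X br L M x ** leg2 (M' x)"
    by (simp add: vec_eq_iff simps)
qed

lemma mbracket_transpose:
  "mbracket X br (\<lambda>x. transpose (M x)) L x = transp1 (mbracket X br M L x)"
  "mbracket X br M (\<lambda>x. transpose (L x)) x = transp2 (mbracket X br M L x)"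
  by (simp_all add: mbracket_def transpose_def transp1_def transp2_def)

end

section \<open>Poisson maps into a space with matrix coordinates\<close>

context matrix_coordinates
begin

text \<open>Bracketing with pulled-back functions is a point derivation at the image point, so the
  brackets have to be compared on matrix entries only. Inverse determinants enter just through the
  condition that their pullbacks are regular.\<close>

lemma poisson_mapI:
  fixes Z :: "'z set"
  assumes "almost_poisson Z RZ brZ" and "almost_poisson X R br"
    and \<phi>: "\<phi> \<in> Z \<rightarrow> X"
    and regular: "\<And>i a b. i \<in> I \<Longrightarrow> (\<lambda>z\<in>Z. M i (\<phi> z) $ a $ b) \<in> RZ"
    and inverse_det: "\<And>i. i \<in> J \<Longrightarrow> (\<lambda>z\<in>Z. inverse (det (M i (\<phi> z)))) \<in> RZ"
    and brackets: "\<And>i k z. i \<in> I \<Longrightarrow> k \<in> I \<Longrightarrow> z \<in> Z \<Longrightarrow>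
      mbracket Z brZ (\<lambda>z. M i (\<phi> z)) (\<lambda>z. M k (\<phi> z)) z = mbracket X br (M i) (M k) (\<phi> z)"
  shows "poisson_map Z RZ brZ X R br \<phi>"
proof -
  interpret A: almost_poisson Z RZ brZ by fact
  interpret B: almost_poisson X R br by fact
  have \<phi>': "\<phi> z \<in> X" if "z \<in> Z" for z
    using \<phi> that by auto
  have compose_restrict: "compose Z (restrict f X) \<phi> = (\<lambda>z\<in>Z. f (\<phi> z))" for f :: "'x \<Rightarrow> complex"
    by (simp add: compose_def \<phi>' cong: restrict_cong)
  have "R \<subseteq> {f \<in> R. compose Z f \<phi> \<in> RZ}"
  proof (rule R_minimal)
    show "function_algebra X {f \<in> R. compose Z f \<phi> \<in> RZ}"
    proof
      fix f g assume fg: "f \<in> {f \<in> R. compose Z f \<phi> \<in> RZ}" "g \<in> {f \<in> R. compose Z f \<phi> \<in> RZ}"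
      then have "(\<lambda>z\<in>Z. f (\<phi> z)) \<in> RZ" "(\<lambda>z\<in>Z. g (\<phi> z)) \<in> RZ"
        by (auto simp: compose_def)
      then show "(\<lambda>x\<in>X. f x + g x) \<in> {f \<in> R. compose Z f \<phi> \<in> RZ}"
        "(\<lambda>x\<in>X. f x * g x) \<in> {f \<in> R. compose Z f \<phi> \<in> RZ}"
        using fg add mult A.add' A.mult' by (auto simp: compose_restrict)
    qed (use extensional const A.const in \<open>auto simp: compose_restrict\<close>)
    show "coord i a b \<in> {f \<in> R. compose Z f \<phi> \<in> RZ}" if "i \<in> I" for i a b
      using that coord_mem regular by (simp add: coord_def compose_restrict)
    show "(\<lambda>x\<in>X. inverse (det (M i x))) \<in> {f \<in> R. compose Z f \<phi> \<in> RZ}" if "i \<in> J" for i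
      using that inverse_det_mem inverse_det by (simp add: compose_restrict)
  qed
  then have mem: "compose Z f \<phi> \<in> RZ" if "f \<in> R" for f
    using that by auto
  have compose_add: "compose Z (\<lambda>x\<in>X. f x + g x) \<phi> = (\<lambda>z\<in>Z. compose Z f \<phi> z + compose Z g \<phi> z)"
    and compose_mult: "compose Z (\<lambda>x\<in>X. f x * g x) \<phi> = (\<lambda>z\<in>Z. compose Z f \<phi> z * compose Z g \<phi> z)"
    for f g
    by (auto simp: compose_def \<phi>' intro!: restrict_ext)
  have derivation: "point_derivation X R (\<phi> z) (\<lambda>f. brZ (compose Z f \<phi>) h z)"
    "point_derivation X R (\<phi> z) (\<lambda>f. brZ h (compose Z f \<phi>) z)" if "h \<in> RZ" "z \<in> Z" for h z
    using that by (auto simp: point_derivation_def compose_add compose_mult compose_restrict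
        A.br_const A.br_add A.br_mult mem) (auto simp: compose_def)
  have coords: "brZ (compose Z (coord i a b) \<phi>) (compose Z (coord k c d) \<phi>) z =
      br (coord i a b) (coord k c d) (\<phi> z)" if "i \<in> I" "k \<in> I" "z \<in> Z" for i k a b c d z
    using brackets[OF that]
    by (simp add: mbracket_def vec_eq_iff coord_def compose_restrict)
  have 1: "brZ (compose Z f \<phi>) (compose Z (coord k c d) \<phi>) z = br f (coord k c d) (\<phi> z)"
    if "f \<in> R" "k \<in> I" "z \<in> Z" for f k c d z
    by (rule point_derivation_eqI[OF derivation(1) B.point_derivation_br(1)])
      (use that coords \<phi>' coord_mem mem in auto)
  have 2: "brZ (compose Z f \<phi>) (compose Z g \<phi>) z = br f g (\<phi> z)" if "f \<in> R" "g \<in> R" "z \<in> Z" for f g z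
    by (rule point_derivation_eqI[OF derivation(2) B.point_derivation_br(2)])
      (use that 1 \<phi>' coord_mem mem in auto)
  have "brZ (compose Z f \<phi>) (compose Z g \<phi>) = compose Z (br f g) \<phi>" if "f \<in> R" "g \<in> R" for f g
  proof (rule extensionalityI)
    show "brZ (compose Z f \<phi>) (compose Z g \<phi>) \<in> extensional Z"
      by (intro A.extensional A.br_mem mem that)
    show "compose Z (br f g) \<phi> \<in> extensional Z"
      by simp
    show "brZ (compose Z f \<phi>) (compose Z g \<phi>) z = compose Z (br f g) \<phi> z" if "z \<in> Z" for z
      using 2 \<open>f \<in> R\<close> \<open>g \<in> R\<close> that by (simp add: compose_eq)
  qed
  with \<phi> mem show ?thesis
    by (simp add: poisson_map_def)
qed

end

subsection \<open>Chains of matrices\<close>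

datatype symbol = SymA | SymB nat | SymC nat

definition chain_symbols :: "nat \<Rightarrow> symbol set" where
  "chain_symbols j = insert SymA (SymB ` {1..j} \<union> SymC ` {1..j})"

text \<open>The positions 2 and 3 leave 0, 1 below and 4, 5 above for column slots that join the
  group. C stands above B, as the bracket of C with B has + r on the left.\<close>

definition row_slot :: "symbol \<Rightarrow> slot" where
  "row_slot i = (case i of SymA \<Rightarrow> (0, 2) | SymB k \<Rightarrow> (2 * k, 2) | SymC k \<Rightarrow> (2 * k, 3))"

text \<open>The slots of a group are totally ordered. The column slots of the k-th pair of matrices join
  the group of the row slots of the preceding pair (of the form if k = 1), above or below them;
  if Q vanishes they form a group of their own.\<close>

definition link_slot :: "'n::{finite,linorder} tensor \<Rightarrow> nat \<Rightarrow> nat \<Rightarrow> slot" where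
  "link_slot Q k r = (if Q = 0 then (2 * k + 1, r) else if Q = transp1 rmat then (2 * k, r + 4) else (2 * k, r))"

text \<open>Among the columns C stands below B, opposite to the rows, because r acts from the right
  with the sign -. The column of the form shares the group of its row and lies above it.\<close>

definition col_slot :: "(nat \<Rightarrow> 'n::{finite,linorder} tensor) \<Rightarrow> symbol \<Rightarrow> slot" where
  "col_slot Q i = (case i of SymA \<Rightarrow> (0, 3) | SymB k \<Rightarrow> link_slot (Q (k - 1)) (k - 1) 1
     | SymC k \<Rightarrow> link_slot (Q (k - 1)) (k - 1) 0)"

lemma linked_link_slot:
  assumes "Q \<in> {0, - transp2 rmat, transp1 rmat}" "r \<le> 1" "\<And>t. t \<in> T \<Longrightarrow> fst t = 2 * k \<and> snd t \<in> {2, 3}"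
  shows "linked Q (link_slot Q k r) T"
proof -
  have t: "fst t = 2 * k" "r < snd t" "snd t < r + 4" if "t \<in> T" for t
    using assms(3)[OF that] assms(2) by auto
  consider "Q = 0" | "Q \<noteq> 0" "Q = transp1 rmat" | "Q \<noteq> 0" "Q \<noteq> transp1 rmat" "Q = - transp2 rmat"
    using assms(1) by blast
  then show ?thesis
  proof cases
    case 1
    then have "link_slot Q k r = (2 * k + 1, r)" by (simp add: link_slot_def)
    with 1 show ?thesis unfolding linked_def by (simp add: t)
  next
    case 2
    then have "link_slot Q k r = (2 * k, r + 4)" by (simp add: link_slot_def)
    with 2(2) show ?thesis unfolding linked_def by (simp add: t)
  next
    case 3
    then have "link_slot Q k r = (2 * k, r)" by (simp add: link_slot_def)
    with 3(3) show ?thesis unfolding linked_def by (simp add: t)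
  qed
qed

lemma fst_link_slot: "fst (link_slot Q k r) = 2 * k \<or> fst (link_slot Q k r) = 2 * k + 1"
  by (simp add: link_slot_def)

lemma snd_link_slot: "snd (link_slot Q k r) = r \<or> snd (link_slot Q k r) = r + 4"
  by (simp add: link_slot_def)

section \<open>The relations of a chain as a bracket built from slots\<close>

locale chain_coordinates =
  matrix_coordinates X "chain_symbols j" "chain_symbols j - {SymA}" M upd
  for X :: "'x set" and j :: nat and M :: "symbol \<Rightarrow> 'x \<Rightarrow> 'n::{finite,linorder} cmat" and upd +
  fixes Q :: "nat \<Rightarrow> 'n tensor"
  assumes Q: "k < j \<Longrightarrow> Q k \<in> {0, - transp2 rmat, transp1 rmat}"
begin

text \<open>Stated for arbitrary coordinate matrices, so that the case j = 1 also describes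
  triples.\<close>

definition relations :: "(('x \<Rightarrow> complex) \<Rightarrow> ('x \<Rightarrow> complex) \<Rightarrow> 'x \<Rightarrow> complex) \<Rightarrow> bool" where
  "relations br \<longleftrightarrow>
     form_rel X br (M SymA) \<and>
     action_rel X br (Q 0) (M (SymB 1)) (M SymA) \<and>
     action_rel X br (Q 0) (M (SymC 1)) (M SymA) \<and>
     (\<forall>k\<in>{2..j}. commute_rel X br (M (SymB k)) (M SymA) \<and> commute_rel X br (M (SymC k)) (M SymA)) \<and>
     (\<forall>k\<in>{1..j}. group_rel X br (M (SymB k)) (M (SymB k)) \<and>
                  group_rel X br (M (SymC k)) (M (SymC k)) \<and>
                  group_rel X br (M (SymC k)) (M (SymB k))) \<and>
     (\<forall>k\<in>{1..<j}. link_rel X br (Q k) (M (SymB (k + 1))) (M (SymB k)) \<and>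
                   link_rel X br (Q k) (M (SymC (k + 1))) (M (SymB k)) \<and>
                   link_rel X br (Q k) (M (SymB (k + 1))) (M (SymC k)) \<and>
                   link_rel X br (Q k) (M (SymC (k + 1))) (M (SymC k))) \<and>
     (\<forall>k\<in>{1..j}. \<forall>l\<in>{1..j}. l + 2 \<le> k \<longrightarrow>
        commute_rel X br (M (SymB k)) (M (SymB l)) \<and>
        commute_rel X br (M (SymC k)) (M (SymB l)) \<and>
        commute_rel X br (M (SymB k)) (M (SymC l)) \<and>
        commute_rel X br (M (SymC k)) (M (SymC l)))"

sublocale slotted_coordinates X "chain_symbols j" "chain_symbols j - {SymA}" M upd row_slot "col_slot Q"
proof
  \<comment> \<open>Halving the group number recovers k - 1, whether or not the columns form a group
    of their own.\<close>
  have fst_div: "fst (col_slot Q (SymB k)) div 2 = k - 1" "fst (col_slot Q (SymC k)) div 2 = k - 1" for k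
    using fst_link_slot[of "Q (k - 1)" "k - 1" 0] fst_link_slot[of "Q (k - 1)" "k - 1" 1]
    by (auto simp: col_slot_def)
  \<comment> \<open>Positions tell the kinds of slots apart: 1 or 5 for columns of B, 0 or 4 for
    columns of C, 2 or 3 for rows. The column of the form, at position 3, differs from the rows of C
    by its group 0.\<close>
  have snd_SymB: "snd (col_slot Q (SymB k)) \<in> {1, 5}" for k
    using snd_link_slot[of "Q (k - 1)" "k - 1" 1] by (auto simp: col_slot_def)
  have snd_SymC: "snd (col_slot Q (SymC k)) \<in> {0, 4}" for k
    using snd_link_slot[of "Q (k - 1)" "k - 1" 0] by (auto simp: col_slot_def)
  have SymA: "col_slot Q SymA = (0, 3)"
    by (simp add: col_slot_def)
  have neq: "col_slot Q (SymB k) \<noteq> col_slot Q (SymC l)" "col_slot Q (SymC k) \<noteq> col_slot Q (SymB l)"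
    "col_slot Q (SymB k) \<noteq> (0, 3)" "col_slot Q (SymC k) \<noteq> (0, 3)"
    "(0, 3) \<noteq> col_slot Q (SymB k)" "(0, 3) \<noteq> col_slot Q (SymC k)" for k l
    using snd_SymB[of k] snd_SymC[of l] snd_SymB[of l] snd_SymC[of k] by (metis insert_iff snd_conv empty_iff
      numeral_eq_iff one_eq_numeral_iff zero_neq_one zero_neq_numeral num.distinct num.inject)+
  have inj: "k = l" if "k \<ge> 1" "l \<ge> 1"
    "col_slot Q (SymB k) = col_slot Q (SymB l) \<or> col_slot Q (SymC k) = col_slot Q (SymC l)" for k l
  proof -
    have "k - 1 = l - 1"
      using that(3) fst_div[of k] fst_div[of l] by auto
    with that(1,2) show ?thesis by simp
  qed
  show "inj_on row_slot (chain_symbols j)"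
    by (auto simp: inj_on_def row_slot_def chain_symbols_def split: symbol.splits)
  show "inj_on (col_slot Q) (chain_symbols j)"
    using inj by (auto simp: inj_on_def chain_symbols_def neq SymA)
  have "snd (row_slot i) \<in> {2, 3}" for i
    by (simp add: row_slot_def split: symbol.splits)
  then have "row_slot i \<noteq> col_slot Q (SymB k)" "row_slot i \<noteq> col_slot Q (SymC k)" for i k
    using snd_SymB[of k] snd_SymC[of k] by (metis insert_iff empty_iff
      numeral_eq_iff one_eq_numeral_iff zero_neq_numeral num.distinct num.inject)+
  then show "row_slot i \<noteq> col_slot Q k" if "i \<in> chain_symbols j" "k \<in> chain_symbols j" for i k
    using that by (auto simp: chain_symbols_def SymA row_slot_def)
qed

definition quad_rel where
  "quad_rel br i k \<longleftrightarrow> (\<forall>x\<in>X. mbracket X br (M i) (M k) x =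
     quad_tensor (row_slot i) (col_slot Q i) (row_slot k) (col_slot Q k) (M i x) (M k x))"

lemma quad_bracket_iff:
  "quad_bracket br \<longleftrightarrow> (\<forall>i\<in>chain_symbols j. \<forall>k\<in>chain_symbols j. quad_rel br i k)"
  unfolding quad_bracket_def quad_rel_def
  by (auto simp: mbracket_def coord_def quad_tensor_def quad_def vec_eq_iff)

text \<open>The relations prescribe each pair of matrices in one order; this supplies the
  other.\<close>

lemma quad_rel_swap:
  assumes "almost_poisson X R br" "i \<in> chain_symbols j" "k \<in> chain_symbols j" "quad_rel br i k"
  shows "quad_rel br k i"
proof -
  interpret almost_poisson X R br by fact
  have eq: "br (coord i a b) (coord k c d) x = quad row_slot (col_slot Q) (\<lambda>i a b. M i x $ a $ b) i a b k c d"
    if "x \<in> X" for a b c d x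
    using assms(4) that by (simp add: quad_rel_def mbracket_def coord_def quad_tensor_def quad_def vec_eq_iff)
  have "br (coord k c d) (coord i a b) x = quad row_slot (col_slot Q) (\<lambda>i a b. M i x $ a $ b) k c d i a b"
    if "x \<in> X" for a b c d x
    using eq[OF that] br_swap[OF coord_mem[OF assms(3)] coord_mem[OF assms(2)] that]
      quad_swap[of row_slot "col_slot Q" _ k c d i a b] by simp
  then show ?thesis
    by (simp add: quad_rel_def mbracket_def coord_def quad_tensor_def quad_def vec_eq_iff)
qed

lemma link_slot_group:
  "fst (link_slot (Q k) k r) \<in> {2 * k, 2 * k + 1}"
  using fst_link_slot[of "Q k" k r] by auto

lemma form_rel_iff: "form_rel X br (M SymA) \<longleftrightarrow> quad_rel br SymA SymA"
  by (simp add: form_rel_def quad_rel_def form_tensor[of "(0, 2)" "(0, 3)"] row_slot_def col_slot_def)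

lemma action_rel_iff:
  assumes "j \<ge> 1"
  shows "action_rel X br (Q 0) (M (SymB 1)) (M SymA) \<longleftrightarrow> quad_rel br (SymB 1) SymA"
    and "action_rel X br (Q 0) (M (SymC 1)) (M SymA) \<longleftrightarrow> quad_rel br (SymC 1) SymA"
proof -
  have "linked (Q 0) (link_slot (Q 0) 0 r) {(0, 2), (0, 3)}" if "r \<le> 1" for r
    using assms Q that by (intro linked_link_slot) auto
  from this[of 0] this[of 1]
  show "action_rel X br (Q 0) (M (SymB 1)) (M SymA) \<longleftrightarrow> quad_rel br (SymB 1) SymA"
    "action_rel X br (Q 0) (M (SymC 1)) (M SymA) \<longleftrightarrow> quad_rel br (SymC 1) SymA"
    unfolding action_rel_def quad_rel_def row_slot_def col_slot_def
    by (simp_all add: action_tensor[symmetric])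
qed

lemma group_rel_iff:
  assumes "k \<in> {1..j}"
  shows "group_rel X br (M (SymB k)) (M (SymB k)) \<longleftrightarrow> quad_rel br (SymB k) (SymB k)"
    and "group_rel X br (M (SymC k)) (M (SymC k)) \<longleftrightarrow> quad_rel br (SymC k) (SymC k)"
    and "group_rel X br (M (SymC k)) (M (SymB k)) \<longleftrightarrow> quad_rel br (SymC k) (SymB k)"
proof -
  have k: "fst (link_slot (Q (k - 1)) (k - 1) r) \<noteq> 2 * k" for r
    using link_slot_group[of "k - 1" r] assms by auto
  have "fst (link_slot (Q (k - 1)) (k - 1) 0) = fst (link_slot (Q (k - 1)) (k - 1) 1)"
    "snd (link_slot (Q (k - 1)) (k - 1) 0) < snd (link_slot (Q (k - 1)) (k - 1) 1)"
    by (simp_all add: link_slot_def)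
  with k k[symmetric] show "group_rel X br (M (SymB k)) (M (SymB k)) \<longleftrightarrow> quad_rel br (SymB k) (SymB k)"
    "group_rel X br (M (SymC k)) (M (SymC k)) \<longleftrightarrow> quad_rel br (SymC k) (SymC k)"
    "group_rel X br (M (SymC k)) (M (SymB k)) \<longleftrightarrow> quad_rel br (SymC k) (SymB k)"
    unfolding group_rel_def quad_rel_def row_slot_def col_slot_def
    by (simp_all add: group_tensor_same[symmetric] group_tensor[symmetric])
qed

lemma link_rel_iff:
  assumes "k \<in> {1..<j}"
  shows "link_rel X br (Q k) (M (SymB (k + 1))) (M (SymB k)) \<longleftrightarrow> quad_rel br (SymB (k + 1)) (SymB k)"
    and "link_rel X br (Q k) (M (SymC (k + 1))) (M (SymB k)) \<longleftrightarrow> quad_rel br (SymC (k + 1)) (SymB k)"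
    and "link_rel X br (Q k) (M (SymB (k + 1))) (M (SymC k)) \<longleftrightarrow> quad_rel br (SymB (k + 1)) (SymC k)"
    and "link_rel X br (Q k) (M (SymC (k + 1))) (M (SymC k)) \<longleftrightarrow> quad_rel br (SymC (k + 1)) (SymC k)"
proof -
  \<comment> \<open>The columns of pair k lie in group 2k - 2 or 2k - 1, below all slots of pair k +
    1.\<close>
  have 1: "2 * (k + 1) \<noteq> fst (link_slot (Q (k - 1)) (k - 1) r)"
    "fst (link_slot (Q k) k r') \<noteq> fst (link_slot (Q (k - 1)) (k - 1) r)" for r r'
    using link_slot_group[of "k - 1" r] link_slot_group[of k r'] assms by auto
  have "leg1 Y ** Q k ** leg2 Z = quad_tensor (Suc (Suc (2 * k)), a) (link_slot (Q k) k r) (2 * k, c)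
      (link_slot (Q (k - Suc 0)) (k - Suc 0) r') Y Z" if "r \<le> 1" "c = 2 \<or> c = 3" for Y Z a r c r'
  proof (rule link_tensor)
    show "linked (Q k) (link_slot (Q k) k r) {(2 * k, c)}"
      using that assms Q by (auto intro!: linked_link_slot)
  qed (use 1 in auto)
  then show "link_rel X br (Q k) (M (SymB (k + 1))) (M (SymB k)) \<longleftrightarrow> quad_rel br (SymB (k + 1)) (SymB k)"
    "link_rel X br (Q k) (M (SymC (k + 1))) (M (SymB k)) \<longleftrightarrow> quad_rel br (SymC (k + 1)) (SymB k)"
    "link_rel X br (Q k) (M (SymB (k + 1))) (M (SymC k)) \<longleftrightarrow> quad_rel br (SymB (k + 1)) (SymC k)"
    "link_rel X br (Q k) (M (SymC (k + 1))) (M (SymC k)) \<longleftrightarrow> quad_rel br (SymC (k + 1)) (SymC k)"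
    unfolding link_rel_def quad_rel_def row_slot_def col_slot_def
    by simp_all
qed

text \<open>Only neighbours in the chain share a group: the slots of pair k have group numbers at
  least 2(k - 1), those of the form and of the pairs up to k - 2 have smaller ones.\<close>

lemma commute_rel_iff:
  assumes "(l = SymA \<and> 2 \<le> k) \<or> (\<exists>n\<ge>1. l \<in> {SymB n, SymC n} \<and> n + 2 \<le> k)"
  shows "commute_rel X br (M (SymB k)) (M l) \<longleftrightarrow> quad_rel br (SymB k) l"
    and "commute_rel X br (M (SymC k)) (M l) \<longleftrightarrow> quad_rel br (SymC k) l"
proof -
  have "2 * (k - 1) \<le> fst (row_slot i) \<and> 2 * (k - 1) \<le> fst (col_slot Q i)" if "i \<in> {SymB k, SymC k}" for i
    using that link_slot_group[of "k - 1" 0] link_slot_group[of "k - 1" 1]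
    by (auto simp: row_slot_def col_slot_def)
  moreover have "fst (row_slot l) < 2 * (k - 1) \<and> fst (col_slot Q l) < 2 * (k - 1)"
    using assms
  proof
    assume "l = SymA \<and> 2 \<le> k"
    then show ?thesis by (auto simp: row_slot_def col_slot_def)
  next
    assume "\<exists>n\<ge>1. l \<in> {SymB n, SymC n} \<and> n + 2 \<le> k"
    then obtain n where "n \<ge> 1" "l \<in> {SymB n, SymC n}" "n + 2 \<le> k" by blast
    then show ?thesis
      using link_slot_group[of "n - 1" 0] link_slot_group[of "n - 1" 1]
      by (auto simp: row_slot_def col_slot_def)
  qed
  ultimately have "fst (row_slot i) \<noteq> fst (row_slot l)" "fst (row_slot i) \<noteq> fst (col_slot Q l)"
    "fst (col_slot Q i) \<noteq> fst (row_slot l)" "fst (col_slot Q i) \<noteq> fst (col_slot Q l)"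
    if "i \<in> {SymB k, SymC k}" for i
    using that by fastforce+
  then show "commute_rel X br (M (SymB k)) (M l) \<longleftrightarrow> quad_rel br (SymB k) l"
    "commute_rel X br (M (SymC k)) (M l) \<longleftrightarrow> quad_rel br (SymC k) l"
    unfolding commute_rel_def quad_rel_def by (simp_all add: commute_tensor[symmetric])
qed

text \<open>Every pair of symbols is covered by a relation in one of its orders, and antisymmetry
  gives the other. For j = 0 the symbols of the first pair, which \<open>relations\<close> mentions
  unconditionally, would be missing.\<close>

lemma relations_iff:
  assumes "almost_poisson X R br" "j \<ge> 1"
  shows "relations br \<longleftrightarrow> quad_bracket br"
proof -
  have "relations br \<longleftrightarrow> quad_rel br SymA SymA \<and> quad_rel br (SymB 1) SymA \<and> quad_rel br (SymC 1) SymA \<and>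
     (\<forall>k\<in>{2..j}. quad_rel br (SymB k) SymA \<and> quad_rel br (SymC k) SymA) \<and>
     (\<forall>k\<in>{1..j}. quad_rel br (SymB k) (SymB k) \<and> quad_rel br (SymC k) (SymC k) \<and>
        quad_rel br (SymC k) (SymB k)) \<and>
     (\<forall>k\<in>{1..<j}. quad_rel br (SymB (k + 1)) (SymB k) \<and> quad_rel br (SymC (k + 1)) (SymB k) \<and>
        quad_rel br (SymB (k + 1)) (SymC k) \<and> quad_rel br (SymC (k + 1)) (SymC k)) \<and>
     (\<forall>k\<in>{1..j}. \<forall>l\<in>{1..j}. l + 2 \<le> k \<longrightarrow>
        quad_rel br (SymB k) (SymB l) \<and> quad_rel br (SymC k) (SymB l) \<and>
        quad_rel br (SymB k) (SymC l) \<and> quad_rel br (SymC k) (SymC l))" (is "_ \<longleftrightarrow> ?quad")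
    unfolding relations_def form_rel_iff action_rel_iff[OF assms(2)]
    by (intro arg_cong2[where f = "(\<and>)"] refl ball_cong imp_cong
        group_rel_iff link_rel_iff commute_rel_iff) auto
  also have "\<dots> \<longleftrightarrow> quad_bracket br"
  proof
    assume quad: ?quad
    have swap: "quad_rel br i k" if "quad_rel br k i" "i \<in> chain_symbols j" "k \<in> chain_symbols j" for i k
      using quad_rel_swap[OF assms(1)] that by blast
    have far: "quad_rel br i SymA" "\<And>l i'. l \<in> {1..j} \<Longrightarrow> l < k \<Longrightarrow> i' \<in> {SymB l, SymC l} \<Longrightarrow> quad_rel br i i'"
      if "k \<in> {1..j}" "i \<in> {SymB k, SymC k}" for i k
    proof -
      show "quad_rel br i SymA"
        using quad that by (cases "k = 1") auto
      show "quad_rel br i i'" if l: "l \<in> {1..j}" "l < k" "i' \<in> {SymB l, SymC l}" for l i'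
      proof (cases "k = l + 1")
        case True
        with l \<open>k \<in> {1..j}\<close> have "l \<in> {1..<j}" by auto
        with quad True l \<open>i \<in> {SymB k, SymC k}\<close> show ?thesis by auto
      next
        case False
        with l have "l + 2 \<le> k" by simp
        with quad l that(1) \<open>k \<in> {1..j}\<close> \<open>i \<in> {SymB k, SymC k}\<close> show ?thesis by auto
      qed
    qed
    have near: "quad_rel br i i'" if "k \<in> {1..j}" "i \<in> {SymB k, SymC k}" "i' \<in> {SymB k, SymC k}" for i i' k
    proof -
      have "SymB k \<in> chain_symbols j" "SymC k \<in> chain_symbols j"
        using that(1) by (auto simp: chain_symbols_def)
      moreover have "quad_rel br (SymB k) (SymB k)" "quad_rel br (SymC k) (SymC k)"
        "quad_rel br (SymC k) (SymB k)"
        using quad that(1) by blast+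
      ultimately show ?thesis
        using that(2,3) swap[of "SymC k" "SymB k"] by auto
    qed
    have symbols: "i = SymA \<or> (\<exists>k\<in>{1..j}. i \<in> {SymB k, SymC k})" if "i \<in> chain_symbols j" for i
      using that by (auto simp: chain_symbols_def)
    have "quad_rel br i i'" if i: "i \<in> chain_symbols j" "i' \<in> chain_symbols j" for i i'
    proof -
      consider "i = SymA" "i' = SymA" | k where "i' = SymA" "k \<in> {1..j}" "i \<in> {SymB k, SymC k}"
        | k where "i = SymA" "k \<in> {1..j}" "i' \<in> {SymB k, SymC k}"
        | k l where "k \<in> {1..j}" "i \<in> {SymB k, SymC k}" "l \<in> {1..j}" "i' \<in> {SymB l, SymC l}"
        using symbols[OF i(1)] symbols[OF i(2)] by blast
      then show ?thesis
      proof cases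
        case 1
        with quad show ?thesis by blast
      next
        case (2 k)
        with far(1) show ?thesis by blast
      next
        case (3 k)
        with far(1) swap i show ?thesis by blast
      next
        case (4 k l)
        consider "l < k" | "k = l" | "k < l" by linarith
        then show ?thesis
        proof cases
          case 1
          with far(2) 4 show ?thesis by blast
        next
          case 2
          with near 4 show ?thesis by blast
        next
          case 3
          with far(2) 4 swap[OF _ i] show ?thesis by blast
        qed
      qed
    qed
    then show "quad_bracket br"
      by (simp add: quad_bracket_iff)
  next
    assume "quad_bracket br"
    then have all: "quad_rel br i k" if "i \<in> chain_symbols j" "k \<in> chain_symbols j" for i k
      using that by (simp add: quad_bracket_iff)
    show ?quad
      using assms(2) by (auto intro!: all simp: chain_symbols_def)
  qed
  finally show ?thesis .
qed

theorem poisson_relations_unique_existence: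
  assumes "j \<ge> 1"
  shows "\<exists>!br. poisson_bracket X R br \<and> relations br"
proof -
  have almost: "almost_poisson X R br" if "poisson_bracket X R br" for br
    using that by (simp add: poisson_bracket_iff[OF function_algebra_axioms])
  obtain br where br: "poisson_bracket X R br" "quad_bracket br"
    using poisson_quad_exists by blast
  show ?thesis
  proof (rule ex1I[of _ br])
    show "poisson_bracket X R br \<and> relations br"
      using br almost relations_iff assms by blast
    show "br' = br" if "poisson_bracket X R br' \<and> relations br'" for br'
      using that br almost relations_iff[OF _ assms] quad_bracket_unique by blast
  qed
qed

end

subsection \<open>Products of matrix-valued functions\<close>

lemma leg_commute:
  "leg2 Y ** leg1 X = leg1 X ** leg2 Y"
  "T ** leg2 Y ** leg1 X = T ** leg1 X ** leg2 Y"
proof -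
  show "leg2 Y ** leg1 X = leg1 X ** leg2 Y"
    by (simp add: vec_eq_iff leg_times_nth leg1_nth leg2_nth if_times sum_delta_conj)
  then show "T ** leg2 Y ** leg1 X = T ** leg1 X ** leg2 Y"
    by (simp add: matrix_mul_assoc[symmetric])
qed

lemma leg_mult: "leg1 (X ** Y) = leg1 X ** leg1 Y" "leg2 (X ** Y) = leg2 X ** leg2 Y"
  by (simp_all add: vec_eq_iff leg_times_nth)
    (simp_all add: leg1_nth leg2_nth if_times sum_delta_conj matrix_matrix_mult_def)

lemma matrix_diff_distrib:
  "(X + Y) ** Z = X ** Z + Y ** Z" "(X - Y) ** Z = X ** Z - Y ** Z" "U ** (X - Y) = U ** X - U ** Y"
  for X Y :: "complex^'n::finite^'m::finite" and Z :: "complex^'k::finite^'n" and U :: "complex^'m^'l::finite"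
  by (simp_all add: matrix_matrix_mult_def vec_eq_iff algebra_simps sum_subtractf sum.distrib)

lemmas tensor_distrib = matrix_add_ldistrib matrix_diff_distrib
  matrix_times_uminus matrix_times_0

lemma flip_simps:
  "flip (S ** T) = flip S ** flip T" "flip (leg1 X) = leg2 X" "flip (leg2 X) = leg1 X"
  "flip (S + T) = flip S + flip T" "flip (S - T) = flip S - flip T" "flip (- T) = - flip T" "flip 0 = 0"
  "flip (transp1 T) = transp2 (flip T)" "flip (transp2 T) = transp1 (flip T)"
proof -
  have "(\<Sum>r\<in>UNIV. S $ prod.swap p $ r * T $ r $ prod.swap q) =
      (\<Sum>r\<in>UNIV. S $ prod.swap p $ prod.swap r * T $ prod.swap r $ prod.swap q)" for p q
    by (rule sum.reindex_bij_witness[of _ prod.swap prod.swap]) auto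
  then show "flip (S ** T) = flip S ** flip T"
    by (simp add: flip_def matrix_matrix_mult_def vec_eq_iff)
qed (simp_all add: flip_def vec_eq_iff leg1_nth leg2_nth transp1_def transp2_def)

lemma transp_leg:
  "transp1 (leg1 X ** T) = transp1 T ** leg1 (transpose X)"
  "transp1 (T ** leg1 X) = leg1 (transpose X) ** transp1 T"
  "transp1 (leg2 X ** T) = leg2 X ** transp1 T"
  "transp1 (T ** leg2 X) = transp1 T ** leg2 X"
  "transp2 (leg1 X ** T) = leg1 X ** transp2 T"
  "transp2 (T ** leg2 X) = leg2 (transpose X) ** transp2 T"
  by (simp_all add: vec_eq_iff transp1_def transp2_def leg_times_nth transpose_def mult.commute)

lemma transp_add: "transp1 (S + T) = transp1 S + transp1 T" "transp2 (S + T) = transp2 S + transp2 T"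
  "transp1 (S - T) = transp1 S - transp1 T" "transp2 (S - T) = transp2 S - transp2 T"
  by (simp_all add: transp1_def transp2_def vec_eq_iff)

lemma flip_rmat: "flip (transp1 rmat) = transp1 rmat" "flip (transp2 rmat) = transp2 rmat"
  by (auto simp: vec_eq_iff flip_def transp1_rmat_nth transp2_rmat_nth)

lemma flip_Q: "Q \<in> {0, - transp2 rmat, transp1 rmat} \<Longrightarrow> flip Q = Q"
  by (auto simp: flip_rmat) (simp_all add: flip_simps(6,7) flip_rmat)

text \<open>Full transposition reverses products and turns r_12 into r_21, giving the commutator
  with - r_21. This agrees with the one with r_12 because r_12 + r_21 is twice the permutation,
  which commutes with a tensor square.\<close>

lemma transp_group:
  "transp1 (transp2 (rmat ** leg1 X ** leg2 X - leg1 X ** leg2 X ** rmat)) =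
    rmat ** leg1 (transpose X) ** leg2 (transpose X) - leg1 (transpose X) ** leg2 (transpose X) ** rmat"
  by (auto simp: vec_eq_iff transp1_def transp2_def rmat_leg_nth transpose_def osgn_def algebra_simps)

primrec matrix_prod :: "(nat \<Rightarrow> 'x \<Rightarrow> 'n::finite cmat) \<Rightarrow> nat \<Rightarrow> 'x \<Rightarrow> 'n cmat" where
  "matrix_prod M 0 x = mat 1"
| "matrix_prod M (Suc k) x = M (Suc k) x ** matrix_prod M k x"

lemma matrix_prod_Suc: "matrix_prod M (Suc k) = (\<lambda>x. M (Suc k) x ** matrix_prod M k x)"
  by auto

context almost_poisson
begin

lemma regular_matrix_prod:
  "(\<And>l. l \<in> {1..k} \<Longrightarrow> regular (M l)) \<Longrightarrow> regular (matrix_prod M k)"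
proof (induction k)
  case 0
  then show ?case by (simp add: regular_const)
next
  case (Suc k)
  then show ?case using regular_mult[of "M (Suc k)" "matrix_prod M k"] by simp
qed

lemma commute_matrix_prod:
  assumes "regular N" "\<And>l. l \<in> {1..k} \<Longrightarrow> regular (M l)" "\<And>l. l \<in> {1..k} \<Longrightarrow> commute_rel X br N (M l)"
  shows "commute_rel X br N (matrix_prod M k)"
  using assms(2,3)
proof (induction k)
  case 0
  then show ?case by (simp add: commute_rel_def mbracket_const2[OF assms(1)])
next
  case (Suc k)
  then show ?case
    using mbracket_mult(2)[OF _ regular_matrix_prod[of k M] assms(1), of "M (Suc k)"]
    by (simp add: commute_rel_def tensor_distrib)
qed

text \<open>Only the leftmost factor of the product is linked to \<open>N\<close>; the others
  commute with \<open>N\<close> and are carried along on the right.\<close>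

lemma link_matrix_prod:
  assumes "regular N" "\<And>l. l \<in> {1..Suc k} \<Longrightarrow> regular (M l)"
    "\<And>l. l \<in> {1..k} \<Longrightarrow> commute_rel X br N (M l)" "link_rel X br Q N (M (Suc k))"
  shows "link_rel X br Q N (matrix_prod M (Suc k))"
  using mbracket_mult(2)[OF _ regular_matrix_prod[of k M] assms(1), of "M (Suc k)"] assms
    commute_matrix_prod[of N k M]
  unfolding matrix_prod_Suc by (simp add: link_rel_def commute_rel_def tensor_distrib leg_mult matrix_mul_assoc)

text \<open>Only the rightmost factor meets \<open>A\<close>. The other factors multiply on the left
  in the first leg, where the action formula also has its group element.\<close>

lemma action_matrix_prod:
  assumes "regular A" "\<And>l. l \<in> {1..Suc k} \<Longrightarrow> regular (M l)"
    "\<And>l. l \<in> {2..Suc k} \<Longrightarrow> commute_rel X br (M l) A" "action_rel X br Q (M 1) A"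
  shows "action_rel X br Q (matrix_prod M (Suc k)) A"
  using assms(2,3)
proof (induction k)
  case 0
  then show ?case
    using assms(4) by (simp add: action_rel_def cong: mbracket_def)
next
  case (Suc k)
  then show ?case
    using mbracket_mult(1)[OF _ regular_matrix_prod[of "Suc k" M] assms(1), of "M (Suc (Suc k))"]
    unfolding matrix_prod_Suc[of M "Suc k"]
    by (simp add: action_rel_def commute_rel_def tensor_distrib leg_mult matrix_mul_assoc
        del: matrix_prod.simps)
qed

text \<open>In the Leibniz expansion the terms with r between the factors cancel, as for the
  multiplication of a Poisson-Lie group. The two cross brackets contribute the same Q term with
  opposite signs, which uses the symmetry of Q under exchange of the factors.\<close>

lemma group_rel_mult:
  assumes "regular M" "regular M'" "regular L" "regular L'" "flip Q = Q"
    "group_rel X br M L" "group_rel X br M' L'" "link_rel X br Q M L'" "link_rel X br Q L M'"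
  shows "group_rel X br (\<lambda>x. M x ** M' x) (\<lambda>x. L x ** L' x)"
  unfolding group_rel_def
proof
  fix x assume x: "x \<in> X"
  have "mbracket X br M' L x = - (leg2 (L x) ** Q ** leg1 (M' x))"
    using mbracket_flip[OF assms(2,3) x] assms(5,9) x by (simp add: link_rel_def flip_simps)
  then have "mbracket X br (\<lambda>x. M x ** M' x) (\<lambda>x. L x ** L' x) x =
      leg1 (M x) ** (leg2 (L x) ** (rmat ** leg1 (M' x) ** leg2 (L' x) - leg1 (M' x) ** leg2 (L' x) ** rmat)
        + - (leg2 (L x) ** Q ** leg1 (M' x)) ** leg2 (L' x))
      + (leg2 (L x) ** (leg1 (M x) ** Q ** leg2 (L' x))
        + (rmat ** leg1 (M x) ** leg2 (L x) - leg1 (M x) ** leg2 (L x) ** rmat) ** leg2 (L' x)) ** leg1 (M' x)"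
    using assms x by (simp add: mbracket_mult regular_mult group_rel_def link_rel_def)
  also have "\<dots> = rmat ** leg1 (M x ** M' x) ** leg2 (L x ** L' x) - leg1 (M x ** M' x) ** leg2 (L x ** L' x) ** rmat"
    by (simp add: tensor_distrib leg_mult matrix_mul_assoc leg_commute)
  finally show "mbracket X br (\<lambda>x. M x ** M' x) (\<lambda>x. L x ** L' x) x = \<dots>" .
qed

text \<open>Two families are used so that the brackets of B with B, C with C and C with B are
  instances. The induction starts at one factor, since its step uses the link to the leftmost factor
  of the shorter product.\<close>

lemma group_matrix_prod:
  assumes regular: "\<And>l. l \<in> {1..j} \<Longrightarrow> regular (M l)" "\<And>l. l \<in> {1..j} \<Longrightarrow> regular (L l)"
    and group: "\<And>k. k \<in> {1..j} \<Longrightarrow> group_rel X br (M k) (L k)"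
    and link: "\<And>k. k \<in> {1..<j} \<Longrightarrow> flip (Q k) = Q k"
      "\<And>k. k \<in> {1..<j} \<Longrightarrow> link_rel X br (Q k) (M (k + 1)) (L k)"
      "\<And>k. k \<in> {1..<j} \<Longrightarrow> link_rel X br (Q k) (L (k + 1)) (M k)"
    and commute: "\<And>k l. k \<in> {1..j} \<Longrightarrow> l \<in> {1..j} \<Longrightarrow> l + 2 \<le> k \<Longrightarrow> commute_rel X br (M k) (L l)"
      "\<And>k l. k \<in> {1..j} \<Longrightarrow> l \<in> {1..j} \<Longrightarrow> l + 2 \<le> k \<Longrightarrow> commute_rel X br (L k) (M l)"
    and k: "Suc k \<le> j"
  shows "group_rel X br (matrix_prod M (Suc k)) (matrix_prod L (Suc k))"
  using k
proof (induction k)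
  case 0
  then show ?case using group[of 1] by (simp add: group_rel_def)
next
  case (Suc k)
  have "group_rel X br (\<lambda>x. M (Suc (Suc k)) x ** matrix_prod M (Suc k) x)
      (\<lambda>x. L (Suc (Suc k)) x ** matrix_prod L (Suc k) x)"
  proof (rule group_rel_mult)
    show "link_rel X br (Q (Suc k)) (M (Suc (Suc k))) (matrix_prod L (Suc k))"
      using Suc.prems regular commute(1) link(2)[of "Suc k"] by (intro link_matrix_prod) auto
    show "link_rel X br (Q (Suc k)) (L (Suc (Suc k))) (matrix_prod M (Suc k))"
      using Suc.prems regular commute(2) link(3)[of "Suc k"] by (intro link_matrix_prod) auto
  qed (use Suc regular group link(1) in \<open>auto intro!: regular_matrix_prod simp del: matrix_prod.simps\<close>)
  then show ?case by simp
qed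

text \<open>The link to \<open>B\<close> yields the term with Q on the left. Transposing the link to
  \<open>C\<close> moves Q to the right as its partial transpose, which yields the other term. Both
  links must therefore carry the same Q.\<close>

lemma action_rel_push:
  assumes "regular N" "regular B" "regular A" "regular C"
    "link_rel X br Q N B" "link_rel X br Q N C" "commute_rel X br N A"
  shows "action_rel X br Q N (\<lambda>x. B x ** A x ** transpose (C x))"
  unfolding action_rel_def
proof
  fix x assume x: "x \<in> X"
  have "mbracket X br N (\<lambda>x. transpose (C x)) x = transp2 (leg1 (N x) ** (Q ** leg2 (C x)))"
    using assms(6) x by (simp add: mbracket_transpose link_rel_def matrix_mul_assoc)
  also have "\<dots> = leg1 (N x) ** (leg2 (transpose (C x)) ** transp2 Q)"
    by (simp add: transp_leg)
  finally have "mbracket X br N (\<lambda>x. B x ** A x ** transpose (C x)) x =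
     leg2 (B x ** A x) ** (leg1 (N x) ** (leg2 (transpose (C x)) ** transp2 Q))
     + (leg1 (N x) ** Q ** leg2 (B x)) ** leg2 (A x) ** leg2 (transpose (C x))"
    using assms x
    by (simp add: mbracket_mult regular_mult regular_transpose link_rel_def commute_rel_def tensor_distrib)
  also have "\<dots> = leg1 (N x) ** Q ** leg2 (B x ** A x ** transpose (C x)) +
         leg1 (N x) ** leg2 (B x ** A x ** transpose (C x)) ** transp2 Q"
    by (simp add: leg_mult matrix_mul_assoc leg_commute)
  finally show "mbracket X br N (\<lambda>x. B x ** A x ** transpose (C x)) x = \<dots>" .
qed

lemma commute_rel_push:
  assumes "regular N" "regular B" "regular A" "regular C"
    "commute_rel X br N B" "commute_rel X br N C" "commute_rel X br N A"
  shows "commute_rel X br N (\<lambda>x. B x ** A x ** transpose (C x))"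
  using assms by (simp add: commute_rel_def mbracket_mult mbracket_transpose regular_mult
      regular_transpose tensor_distrib transp_0)

text \<open>In the Leibniz expansion the r terms telescope. The bracket of \<open>C\<close> with
  \<open>B\<close>, transposed in one leg, cancels the inner r^{t_1} terms coming from the bracket
  of \<open>A\<close> with itself and creates the outer ones for the new form. The terms with Q and
  its transposes cancel pairwise between \<open>B\<close> and the transpose of \<open>C\<close>, or
  within the two orders of one bracket.\<close>

lemma form_rel_push:
  assumes regular: "regular B" "regular A" "regular C" and Q: "flip Q = Q"
    and rels: "form_rel X br A" "action_rel X br Q B A" "action_rel X br Q C A"
      "group_rel X br B B" "group_rel X br C C" "group_rel X br C B"
  shows "form_rel X br (\<lambda>x. B x ** A x ** transpose (C x))"
  unfolding form_rel_def
proof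
  fix x assume x: "x \<in> X"
  let ?A1 = "leg1 (A x)" and ?A2 = "leg2 (A x)" and ?B1 = "leg1 (B x)" and ?B2 = "leg2 (B x)"
    and ?C1 = "leg1 (C x)" and ?K1 = "leg1 (transpose (C x))" and ?K2 = "leg2 (transpose (C x))"
    and ?K = "\<lambda>x. transpose (C x)" and ?s = "transp1 rmat"
  note regs = regular regular_transpose[OF regular(3)] x
  have BA: "mbracket X br B A x = ?B1 ** Q ** ?A2 + ?B1 ** ?A2 ** transp2 Q"
    using rels x by (simp add: action_rel_def)
  have AB: "mbracket X br A B x = - (?B2 ** Q ** ?A1 + ?B2 ** ?A1 ** transp1 Q)"
    using mbracket_flip[of A B x] regs BA Q by (simp add: flip_simps)
  have "mbracket X br ?K A x = transp1 (?C1 ** (Q ** ?A2) + ?C1 ** (?A2 ** transp2 Q))"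
    using rels x by (simp add: mbracket_transpose action_rel_def matrix_mul_assoc)
  then have KA: "mbracket X br ?K A x = transp1 Q ** ?A2 ** ?K1 + ?A2 ** transp1 (transp2 Q) ** ?K1"
    by (simp add: transp_add transp_leg)
  have AK: "mbracket X br A ?K x = - (transp2 Q ** ?A1 ** ?K2 + ?A1 ** transp2 (transp1 Q) ** ?K2)"
    using mbracket_flip[of A ?K x] regs KA Q by (simp add: flip_simps)
  have transp_commute: "transp2 (transp1 Q) = transp1 (transp2 Q)"
    by (simp add: transp1_def transp2_def vec_eq_iff)
  have "mbracket X br ?K B x = transp1 (rmat ** ?B2 ** ?C1 - ?C1 ** (?B2 ** rmat))"
    using rels x by (simp add: mbracket_transpose group_rel_def matrix_mul_assoc leg_commute)
  also have "\<dots> = ?K1 ** ?s ** ?B2 - ?B2 ** ?s ** ?K1"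
    by (simp add: transp_add transp_leg) (simp add: matrix_mul_assoc)
  finally have KB: "mbracket X br ?K B x = ?K1 ** ?s ** ?B2 - ?B2 ** ?s ** ?K1" .
  have BK: "mbracket X br B ?K x = ?B1 ** ?s ** ?K2 - ?K2 ** ?s ** ?B1"
    using mbracket_flip[of B ?K x] regs KB by (simp add: flip_simps(1-6) flip_rmat)
  have KK: "mbracket X br ?K ?K x = rmat ** ?K1 ** ?K2 - ?K1 ** ?K2 ** rmat"
    using rels x by (simp add: mbracket_transpose group_rel_def transp_group)
  have BB: "mbracket X br B B x = rmat ** ?B1 ** ?B2 - ?B1 ** ?B2 ** rmat"
    using rels x by (simp add: group_rel_def)
  have AA: "mbracket X br A A x = rmat ** ?A1 ** ?A2 - ?A1 ** ?A2 ** rmat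
       + ?A1 ** ?s ** ?A2 - ?A2 ** ?s ** ?A1"
    using rels x by (simp add: form_rel_def)
  show "mbracket X br (\<lambda>x. B x ** A x ** transpose (C x)) (\<lambda>x. B x ** A x ** transpose (C x)) x =
     rmat ** leg1 (B x ** A x ** transpose (C x)) ** leg2 (B x ** A x ** transpose (C x))
     - leg1 (B x ** A x ** transpose (C x)) ** leg2 (B x ** A x ** transpose (C x)) ** rmat
     + leg1 (B x ** A x ** transpose (C x)) ** ?s ** leg2 (B x ** A x ** transpose (C x))
     - leg2 (B x ** A x ** transpose (C x)) ** ?s ** leg1 (B x ** A x ** transpose (C x))"
    by (simp add: mbracket_mult regular_mult regs AA AB BA AK KA BK KB KK BB transp_commute)
      (simp add: tensor_distrib leg_mult matrix_mul_assoc leg_commute)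
qed

end

subsection \<open>The spaces of triples and of chains\<close>

lemma inverse_det_matrix_mult:
  "inverse (det (X ** Y)) = inverse (det X) * inverse (det (Y :: 'n::finite cmat))"
  by (simp add: det_mul)

text \<open>Triples appear as chains of length one, where the number in a symbol is always
  1.\<close>

definition triple_matrix :: "symbol \<Rightarrow> 'n::finite triple \<Rightarrow> 'n cmat" where
  "triple_matrix i = (case i of SymA \<Rightarrow> trA | SymB _ \<Rightarrow> trB | SymC _ \<Rightarrow> trC)"

lemma triple_matrix_simps:
  "triple_matrix SymA = trA" "triple_matrix (SymB k) = trB" "triple_matrix (SymC k) = trC"
  by (simp_all add: triple_matrix_def)

definition triple_upd :: "symbol \<Rightarrow> 'n::finite cmat \<Rightarrow> 'n triple \<Rightarrow> 'n triple" where
  "triple_upd i Y t = (case i of SymA \<Rightarrow> (Y, trB t, trC t) | SymB _ \<Rightarrow> (trA t, Y, trC t) | SymC _ \<Rightarrow> (trA t, trB t, Y))"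

lemma chain_symbols_1: "chain_symbols (Suc 0) = {SymA, SymB 1, SymC 1}"
  by (auto simp: chain_symbols_def)

lemma chain_coordinates_triples:
  assumes "Q \<in> {0, - transp2 rmat, transp1 rmat}"
  shows "chain_coordinates triples (Suc 0) triple_matrix triple_upd (\<lambda>_. Q)"
  by unfold_locales
    (use assms in \<open>auto simp: chain_symbols_1 triple_matrix_def triple_upd_def triples_def GL_def
      trA_def trB_def trC_def\<close>)

definition chain_matrix :: "symbol \<Rightarrow> 'n::finite chain \<Rightarrow> 'n cmat" where
  "chain_matrix i = (case i of SymA \<Rightarrow> chA | SymB k \<Rightarrow> chB k | SymC k \<Rightarrow> chC k)"

definition chain_upd :: "symbol \<Rightarrow> 'n::finite cmat \<Rightarrow> 'n chain \<Rightarrow> 'n chain" where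
  "chain_upd i Y s = (case i of SymA \<Rightarrow> (Y, snd s) | SymB k \<Rightarrow> (chA s, (snd s)(k := (Y, chC k s)))
     | SymC k \<Rightarrow> (chA s, (snd s)(k := (chB k s, Y))))"

lemma chains_mem:
  "s \<in> chains j \<Longrightarrow> k \<in> {1..j} \<Longrightarrow> chB k s \<in> GL \<and> chC k s \<in> GL"
proof -
  assume "s \<in> chains j" "k \<in> {1..j}"
  then have "snd s k \<in> GL \<times> GL"
    by (intro PiE_mem[of "snd s" "{1..j}"]) (simp_all add: chains_def mem_Times_iff)
  then show ?thesis by (simp add: chB_def chC_def mem_Times_iff)
qed

lemma chain_coordinates_chains:
  assumes "\<And>k. k < j \<Longrightarrow> Q k \<in> {0, - transp2 rmat, transp1 rmat}"
  shows "chain_coordinates (chains j) j chain_matrix chain_upd Q"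
proof
  show "finite (chain_symbols j)" "chain_symbols j - {SymA} \<subseteq> chain_symbols j"
    by (auto simp: chain_symbols_def)
  show "chain_upd i Y s \<in> chains j"
    if "s \<in> chains j" "i \<in> chain_symbols j" "i \<in> chain_symbols j - {SymA} \<Longrightarrow> invertible Y" for s i Y
  proof -
    have s: "snd s \<in> {1..j} \<rightarrow>\<^sub>E GL \<times> GL"
      using that(1) by (simp add: chains_def mem_Times_iff)
    have upd: "(a, (snd s)(k := (B, C))) \<in> chains j" if "k \<in> {1..j}" "B \<in> GL" "C \<in> GL" for k a B C
    proof -
      have "(snd s)(k := (B, C)) \<in> {1..j} \<rightarrow>\<^sub>E GL \<times> GL"
        using s that by (auto simp: PiE_iff extensional_def)
      then show ?thesis by (simp add: chains_def)
    qed
    show ?thesis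
    proof (cases i)
      case SymA
      with s show ?thesis by (simp add: chain_upd_def chains_def)
    next
      case (SymB k)
      with that have "k \<in> {1..j}" "Y \<in> GL" by (auto simp: chain_symbols_def GL_def)
      with SymB chains_mem[OF that(1)] show ?thesis by (simp add: chain_upd_def upd)
    next
      case (SymC k)
      with that have "k \<in> {1..j}" "Y \<in> GL" by (auto simp: chain_symbols_def GL_def)
      with SymC chains_mem[OF that(1)] show ?thesis by (simp add: chain_upd_def upd)
    qed
  qed
  show "invertible (chain_matrix i s)" if "s \<in> chains j" "i \<in> chain_symbols j - {SymA}" for s i
    using that chains_mem[OF that(1)] by (auto simp: chain_symbols_def chain_matrix_def GL_def)
qed (use assms in \<open>auto simp: chain_symbols_def chain_matrix_def chain_upd_def chA_def chB_def chC_def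
    split: if_splits\<close>)

lemma triple_functions_eq:
  fixes Q :: "'n::{finite,linorder} tensor"
  assumes "Q \<in> {0, - transp2 rmat, transp1 rmat}"
  shows "matrix_coordinates.R triples (chain_symbols (Suc 0)) (chain_symbols (Suc 0) - {SymA}) triple_matrix =
    (triple_functions :: ('n triple \<Rightarrow> complex) set)"
proof -
  interpret chain_coordinates triples "Suc 0" triple_matrix triple_upd "\<lambda>_. Q"
    by (rule chain_coordinates_triples) fact
  have "generators = entries trA \<union> GL_coordinates trB \<union> GL_coordinates trC"
    unfolding generators_def by (auto simp: chain_symbols_1 triple_matrix_def GL_coordinates_def)
  then show ?thesis
    by (simp only: R_def triple_functions_def)
qed

lemma triple_poisson_structure_unique_existence:
  assumes "Q \<in> {0, - transp2 rmat, transp1 rmat}"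
  shows "\<exists>!br. triple_poisson_structure Q br"
proof -
  interpret T: chain_coordinates triples "Suc 0" triple_matrix triple_upd "\<lambda>_. Q"
    by (rule chain_coordinates_triples) fact
  \<comment> \<open>At length one the link conditions and the commutation conditions are
    vacuous.\<close>
  have "T.relations br \<longleftrightarrow> form_rel triples br trA \<and>
     action_rel triples br Q trB trA \<and> action_rel triples br Q trC trA \<and>
     group_rel triples br trB trB \<and> group_rel triples br trC trC \<and> group_rel triples br trC trB" for br
    unfolding T.relations_def by (simp add: triple_matrix_def)
  then have "triple_poisson_structure Q br \<longleftrightarrow> poisson_bracket triples T.R br \<and> T.relations br" for br
    unfolding triple_poisson_structure_def triple_functions_eq[OF assms] by simp
  then show ?thesis
    using T.poisson_relations_unique_existence by simp
qed

lemma chain_functions_eq: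
  fixes Q :: "nat \<Rightarrow> 'n::{finite,linorder} tensor"
  assumes "\<And>k. k < j \<Longrightarrow> Q k \<in> {0, - transp2 rmat, transp1 rmat}"
  shows "matrix_coordinates.R (chains j) (chain_symbols j) (chain_symbols j - {SymA}) chain_matrix =
    (chain_functions j :: ('n chain \<Rightarrow> complex) set)"
proof -
  interpret chain_coordinates "chains j" j chain_matrix chain_upd Q
    by (rule chain_coordinates_chains) fact
  have "generators = entries chA \<union> (\<Union>k\<in>{1..j}. GL_coordinates (chB k) \<union> GL_coordinates (chC k))"
    unfolding generators_def by (auto simp: chain_symbols_def chain_matrix_def GL_coordinates_def)
  then show ?thesis
    by (simp only: R_def chain_functions_def)
qed

lemma chain_poisson_structure_unique_existence:
  fixes Q :: "nat \<Rightarrow> 'n::{finite,linorder} tensor"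
  assumes "j \<ge> 1" "\<And>k. k < j \<Longrightarrow> Q k \<in> {0, - transp2 rmat, transp1 rmat}"
  shows "\<exists>!br. chain_poisson_structure j Q br"
proof -
  interpret C: chain_coordinates "chains j" j chain_matrix chain_upd Q
    by (rule chain_coordinates_chains) fact
  have R: "C.R = chain_functions j"
    using chain_functions_eq[OF assms(2)] .
  have "chain_poisson_structure j Q br \<longleftrightarrow> poisson_bracket (chains j) C.R br \<and> C.relations br" for br
    unfolding chain_poisson_structure_def C.relations_def R
    by (simp add: chain_matrix_def)
  then show ?thesis
    using C.poisson_relations_unique_existence[OF assms(1)] by simp
qed

section \<open>Poisson maps from chains to triples, and compatibility\<close>

lemma poisson_map_to_triples:
  fixes A B C :: "'z \<Rightarrow> 'n::{finite,linorder} cmat"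
  assumes "almost_poisson Z RZ br" "Q \<in> {0, - transp2 rmat, transp1 rmat}"
    and regular: "almost_poisson.regular Z RZ A" "almost_poisson.regular Z RZ B" "almost_poisson.regular Z RZ C"
    and GL: "\<And>z. z \<in> Z \<Longrightarrow> B z \<in> GL \<and> C z \<in> GL"
    and det: "(\<lambda>z\<in>Z. inverse (det (B z))) \<in> RZ" "(\<lambda>z\<in>Z. inverse (det (C z))) \<in> RZ"
    and rels: "form_rel Z br A" "action_rel Z br Q B A" "action_rel Z br Q C A"
      "group_rel Z br B B" "group_rel Z br C C" "group_rel Z br C B"
  shows "\<exists>br'. triple_poisson_structure Q br' \<and>
    poisson_map Z RZ br triples triple_functions br' (\<lambda>z. (A z, B z, C z))"
proof -
  interpret Z: almost_poisson Z RZ br by fact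
  interpret T: chain_coordinates triples "Suc 0" triple_matrix triple_upd "\<lambda>_. Q"
    by (rule chain_coordinates_triples) fact
  obtain br' where br': "triple_poisson_structure Q br'"
    using triple_poisson_structure_unique_existence[OF assms(2)] by blast
  note R = triple_functions_eq[OF assms(2)]
  have almost: "almost_poisson triples T.R br'"
    using br' poisson_bracket_iff[OF T.function_algebra_axioms]
    unfolding R triple_poisson_structure_def by blast
  interpret T: almost_poisson triples T.R br' by fact
  have mem: "(A z, B z, C z) \<in> triples" if "z \<in> Z" for z
    using GL[OF that] by (simp add: triples_def)
  have M: "(\<lambda>z. triple_matrix i (A z, B z, C z)) = (case i of SymA \<Rightarrow> A | SymB _ \<Rightarrow> B | SymC _ \<Rightarrow> C)" for i
    by (auto simp: triple_matrix_def trA_def trB_def trC_def split: symbol.split)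
  have T_regular: "T.regular trA" "T.regular trB" "T.regular trC"
  proof -
    have "T.regular (triple_matrix i)" if "i \<in> chain_symbols (Suc 0)" for i
      using T.coord_mem[OF that] unfolding T.regular_def T.coord_def by blast
    from this[of SymA] this[of "SymB 1"] this[of "SymC 1"]
    show "T.regular trA" "T.regular trB" "T.regular trC"
      unfolding triple_matrix_simps by (simp_all add: chain_symbols_1)
  qed
  have "poisson_map Z RZ br triples T.R br' (\<lambda>z. (A z, B z, C z))"
  proof (rule T.poisson_mapI)
    show "(\<lambda>z\<in>Z. triple_matrix i (A z, B z, C z) $ a $ b) \<in> RZ" for i a b
      using Z.regularD[OF regular(1)] Z.regularD[OF regular(2)] Z.regularD[OF regular(3)]
      by (cases i) (auto simp: triple_matrix_def trA_def trB_def trC_def)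
    show "(\<lambda>z\<in>Z. inverse (det (triple_matrix i (A z, B z, C z)))) \<in> RZ"
      if "i \<in> chain_symbols (Suc 0) - {SymA}" for i
      using det that by (cases i) (auto simp: triple_matrix_def trA_def trB_def trC_def)
    fix i k :: symbol and z assume z: "z \<in> Z"
    have 1: "mbracket Z br A A z = mbracket triples br' trA trA (A z, B z, C z)"
      "mbracket Z br B A z = mbracket triples br' trB trA (A z, B z, C z)"
      "mbracket Z br C A z = mbracket triples br' trC trA (A z, B z, C z)"
      "mbracket Z br B B z = mbracket triples br' trB trB (A z, B z, C z)"
      "mbracket Z br C C z = mbracket triples br' trC trC (A z, B z, C z)"
      "mbracket Z br C B z = mbracket triples br' trC trB (A z, B z, C z)"
      using br' rels z mem[OF z]
      by (simp_all add: triple_poisson_structure_def form_rel_def action_rel_def group_rel_def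
          trA_def trB_def trC_def)
    \<comment> \<open>The opposite orders follow by exchanging the tensor factors on the source and
      on the target.\<close>
    have 2: "mbracket Z br A B z = mbracket triples br' trA trB (A z, B z, C z)"
      "mbracket Z br A C z = mbracket triples br' trA trC (A z, B z, C z)"
      "mbracket Z br B C z = mbracket triples br' trB trC (A z, B z, C z)"
      using 1 Z.mbracket_flip[OF regular(1,2) z] Z.mbracket_flip[OF regular(1,3) z]
        Z.mbracket_flip[OF regular(2,3) z] T.mbracket_flip[OF T_regular(1,2) mem[OF z]]
        T.mbracket_flip[OF T_regular(1,3) mem[OF z]] T.mbracket_flip[OF T_regular(2,3) mem[OF z]]
      by simp_all
    show "mbracket Z br (\<lambda>z. triple_matrix i (A z, B z, C z)) (\<lambda>z. triple_matrix k (A z, B z, C z)) z =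
        mbracket triples br' (triple_matrix i) (triple_matrix k) (A z, B z, C z)"
      unfolding M by (cases i; cases k) (simp_all add: triple_matrix_def 1 2)
  qed (use assms(1) almost mem in auto)
  with br' show ?thesis
    unfolding R by blast
qed

lemma prod_eq_matrix_prod: "prodB k = matrix_prod chB k" "prodC k = matrix_prod chC k"
  by (induction k; auto)+

lemma chain_poisson_structure_compatible:
  fixes Q :: "nat \<Rightarrow> 'n::{finite,linorder} tensor"
  assumes j: "j \<ge> 1" and Q: "\<And>k. k < j \<Longrightarrow> Q k \<in> {0, - transp2 rmat, transp1 rmat}"
    and br: "chain_poisson_structure j Q br"
  shows "compatible j Q br"
proof -
  interpret C: chain_coordinates "chains j" j chain_matrix chain_upd Q
    by (rule chain_coordinates_chains) fact
  have R: "C.R = chain_functions j"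
    using chain_functions_eq[OF Q] .
  have almost: "almost_poisson (chains j) (chain_functions j) br"
    using br poisson_bracket_iff[OF C.function_algebra_axioms]
    unfolding R chain_poisson_structure_def by blast
  interpret A: almost_poisson "chains j" "chain_functions j" br by fact
  let ?X = "chains j :: 'n chain set"
  have form: "form_rel ?X br chA"
    and action: "action_rel ?X br (Q 0) (chB 1) chA" "action_rel ?X br (Q 0) (chC 1) chA"
    and commute_A: "\<And>k. k \<in> {2..j} \<Longrightarrow> commute_rel ?X br (chB k) chA"
      "\<And>k. k \<in> {2..j} \<Longrightarrow> commute_rel ?X br (chC k) chA"
    and group: "\<And>k. k \<in> {1..j} \<Longrightarrow> group_rel ?X br (chB k) (chB k)"
      "\<And>k. k \<in> {1..j} \<Longrightarrow> group_rel ?X br (chC k) (chC k)"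
      "\<And>k. k \<in> {1..j} \<Longrightarrow> group_rel ?X br (chC k) (chB k)"
    and link: "\<And>k. k \<in> {1..<j} \<Longrightarrow> link_rel ?X br (Q k) (chB (k + 1)) (chB k)"
      "\<And>k. k \<in> {1..<j} \<Longrightarrow> link_rel ?X br (Q k) (chC (k + 1)) (chB k)"
      "\<And>k. k \<in> {1..<j} \<Longrightarrow> link_rel ?X br (Q k) (chB (k + 1)) (chC k)"
      "\<And>k. k \<in> {1..<j} \<Longrightarrow> link_rel ?X br (Q k) (chC (k + 1)) (chC k)"
    and commute: "\<And>k l. k \<in> {1..j} \<Longrightarrow> l \<in> {1..j} \<Longrightarrow> l + 2 \<le> k \<Longrightarrow> commute_rel ?X br (chB k) (chB l)"
      "\<And>k l. k \<in> {1..j} \<Longrightarrow> l \<in> {1..j} \<Longrightarrow> l + 2 \<le> k \<Longrightarrow> commute_rel ?X br (chC k) (chB l)"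
      "\<And>k l. k \<in> {1..j} \<Longrightarrow> l \<in> {1..j} \<Longrightarrow> l + 2 \<le> k \<Longrightarrow> commute_rel ?X br (chB k) (chC l)"
      "\<And>k l. k \<in> {1..j} \<Longrightarrow> l \<in> {1..j} \<Longrightarrow> l + 2 \<le> k \<Longrightarrow> commute_rel ?X br (chC k) (chC l)"
    using br unfolding chain_poisson_structure_def by blast+
  have regular: "A.regular chA" "k \<in> {1..j} \<Longrightarrow> A.regular (chB k)" "k \<in> {1..j} \<Longrightarrow> A.regular (chC k)" for k
    using C.coord_mem[of SymA] C.coord_mem[of "SymB k"] C.coord_mem[of "SymC k"] unfolding R
    by (auto simp: A.regular_def C.coord_def chain_symbols_def chain_matrix_def)
  have inverse_det: "k \<in> {1..j} \<Longrightarrow> (\<lambda>s\<in>?X. inverse (det (chB k s))) \<in> chain_functions j"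
    "k \<in> {1..j} \<Longrightarrow> (\<lambda>s\<in>?X. inverse (det (chC k s))) \<in> chain_functions j" for k
    using C.inverse_det_mem[of "SymB k"] C.inverse_det_mem[of "SymC k"] unfolding R
    by (auto simp: chain_symbols_def chain_matrix_def)
  have flip: "flip (Q k) = Q k" if "k < j" for k
    using Q[OF that] by (rule flip_Q)

  have "poisson_to_triples j br (Q 0) (multiple_product j)"
  proof -
    have GL: "s \<in> ?X \<Longrightarrow> k \<le> j \<Longrightarrow> prodB k s \<in> GL \<and> prodC k s \<in> GL" for s k
    proof (induction k)
      case 0
      then show ?case by (auto simp: GL_def invertible_def intro!: exI[of _ "mat 1"])
    next
      case (Suc k)
      then show ?case
        using chains_mem[of s j "Suc k"] by (auto simp: GL_def intro: invertible_mult)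
    qed
    \<comment> \<open>The inverse determinant of a product is the product of the inverse
      determinants, hence of generators.\<close>
    have det: "k \<le> j \<Longrightarrow> (\<lambda>s\<in>?X. inverse (det (prodB k s))) \<in> chain_functions j \<and>
        (\<lambda>s\<in>?X. inverse (det (prodC k s))) \<in> chain_functions j" for k
      by (induction k) (auto simp: A.const inverse_det_matrix_mult intro!: A.mult' inverse_det
        simp del: inverse_mult_distrib)
    obtain n where n: "Suc n = j"
      using j by (cases j) auto
    have "\<exists>br'. triple_poisson_structure (Q 0) br' \<and> poisson_map ?X (chain_functions j) br
        triples triple_functions br' (\<lambda>s. (chA s, prodB j s, prodC j s))"
    proof (rule poisson_map_to_triples[OF almost])
      show "A.regular (prodB j)" "A.regular (prodC j)"
        unfolding prod_eq_matrix_prod by (intro A.regular_matrix_prod regular; simp)+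
      show "action_rel ?X br (Q 0) (prodB j) chA" "action_rel ?X br (Q 0) (prodC j) chA"
        unfolding prod_eq_matrix_prod
        by (intro A.action_matrix_prod[where k = n, unfolded n] regular action commute_A; simp)+
      show "group_rel ?X br (prodB j) (prodB j)" "group_rel ?X br (prodC j) (prodC j)"
        "group_rel ?X br (prodC j) (prodB j)"
        unfolding prod_eq_matrix_prod
        by (intro A.group_matrix_prod[where Q = Q and j = j and k = n, unfolded n]
          regular group flip link commute; simp)+
    qed (use Q[of 0] j regular GL det form in auto)
    then show ?thesis
      by (simp add: poisson_to_triples_def multiple_product_def[abs_def])
  qed
  moreover have "poisson_to_triples j br (Q (k - 1)) (chain_factor k)" if k: "k \<in> {1..j}" for k
  proof -
    have after: "form_after (Suc n) = (\<lambda>s. chB (Suc n) s ** form_after n s ** transpose (chC (Suc n) s))"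
      for n :: nat
      by (auto simp del: transpose_def)
    \<comment> \<open>The induction also carries commutation with all pairs from n + 2 on: pair n +
      2 must commute with the old form before its links can produce its action on the new
      one.\<close>
    have "n < j \<Longrightarrow> A.regular (form_after n) \<and> form_rel ?X br (form_after n) \<and>
      action_rel ?X br (Q n) (chB (Suc n)) (form_after n) \<and>
      action_rel ?X br (Q n) (chC (Suc n)) (form_after n) \<and>
      (\<forall>l\<in>{n + 2..j}. commute_rel ?X br (chB l) (form_after n) \<and> commute_rel ?X br (chC l) (form_after n))"
      for n
    proof (induction n)
      case 0
      then show ?case
        using form action commute_A regular(1) by (simp add: form_rel_def action_rel_def commute_rel_def)
    next
      case (Suc n)
      then have IH: "A.regular (form_after n)" "form_rel ?X br (form_after n)"
        "action_rel ?X br (Q n) (chB (Suc n)) (form_after n)"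
        "action_rel ?X br (Q n) (chC (Suc n)) (form_after n)"
        "\<And>l. l \<in> {n + 2..j} \<Longrightarrow> commute_rel ?X br (chB l) (form_after n)"
        "\<And>l. l \<in> {n + 2..j} \<Longrightarrow> commute_rel ?X br (chC l) (form_after n)"
        by auto
      from Suc.prems have n: "Suc n \<in> {1..j}" "Suc n \<in> {1..<j}" "Suc (Suc n) \<in> {1..j}" "n < j"
        "Suc (Suc n) \<in> {n + 2..j}" by auto
      have "A.regular (form_after (Suc n))"
        unfolding after by (intro A.regular_mult A.regular_transpose regular n IH)
      moreover have "form_rel ?X br (form_after (Suc n))"
        unfolding after by (rule A.form_rel_push[OF _ _ _ flip]) (use n IH regular group in auto)
      moreover have "action_rel ?X br (Q (Suc n)) (chB (Suc (Suc n))) (form_after (Suc n))"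
        "action_rel ?X br (Q (Suc n)) (chC (Suc (Suc n))) (form_after (Suc n))"
        unfolding after
        using link[OF n(2)] by (intro A.action_rel_push regular n IH; simp)+
      moreover have "commute_rel ?X br (chB l) (form_after (Suc n))"
        "commute_rel ?X br (chC l) (form_after (Suc n))" if "l \<in> {Suc n + 2..j}" for l
        unfolding after
        using that n by (intro A.commute_rel_push regular commute IH; simp)+
      ultimately show ?case by blast
    qed
    from this[of "k - 1"] k have after: "A.regular (form_after (k - 1))" "form_rel ?X br (form_after (k - 1))"
      "action_rel ?X br (Q (k - 1)) (chB k) (form_after (k - 1))"
      "action_rel ?X br (Q (k - 1)) (chC k) (form_after (k - 1))"
      by auto
    have GL: "chB k s \<in> GL \<and> chC k s \<in> GL" if "s \<in> ?X" for s
      using chains_mem[OF that k] .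
    have "\<exists>br'. triple_poisson_structure (Q (k - 1)) br' \<and> poisson_map ?X (chain_functions j) br
        triples triple_functions br' (\<lambda>s. (form_after (k - 1) s, chB k s, chC k s))"
      by (rule poisson_map_to_triples[OF almost])
        (use k Q[of "k - 1"] regular group after inverse_det GL in auto)
    then show ?thesis
      by (simp add: poisson_to_triples_def chain_factor_def[abs_def])
  qed
  ultimately show ?thesis
    by (simp add: compatible_def)
qed

theorem lemma5p1:
  fixes j :: nat and Q :: "nat \<Rightarrow> 'n::{finite,linorder} tensor"
  assumes "j \<ge> 1"
    and "\<And>k. k \<le> j - 1 \<Longrightarrow> Q k \<in> {0, - transp2 rmat, transp1 rmat}"
  shows "(\<exists>!br. chain_poisson_structure j Q br) \<and>
         (\<forall>br. chain_poisson_structure j Q br \<longrightarrow> compatible j Q br)"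
proof -
  have "Q k \<in> {0, - transp2 rmat, transp1 rmat}" if "k < j" for k
    using assms(2)[of k] that by linarith
  with assms(1) show ?thesis
    using chain_poisson_structure_unique_existence chain_poisson_structure_compatible by blast
qed

end
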